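(* Let $k\in\mathbb{N}$ and suppose that $(\phi,\tau)\in\mathcal{C}_1(dx^2)$ is such that the manifold with density $(\mathbb{R}^n,dx^2,e^{-\phi}\mathrm{dvol})$ with parameter $\lambda=\frac{1}{2\tau}$ satisfies $$d\widehat{\sigma}_{k,\phi}=0\quad\text{and}\quad\int_{\mathbb{R}^n}\operatorname{tr}\widehat{E}_{k,\phi}\,e^{-\phi}\,\mathrm{dvol}=0 .$$ Suppose additionally that $(-1)^j\widehat{\sigma}_{j,\phi}>0$ on $\mathbb{R}^n$ for all $j\in\{1,2,\dots,k\}$ and that the function $\widetilde{\phi}(x):=|x|^2\phi\left(x/|x|^2\right)$ extends to a $C^2$ function on $\mathbb{R}^n$ with $\widetilde{\phi}(0)>0$. Then there is a point $x_0\in\mathbb{R}^n$ such that $\phi(x)=\frac{|x-x_0|^2}{4\tau}$ for all $x\in\mathbb{R}^n$.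
   Context: $\mathcal{C}_1(dx^2):=\{(\phi,\tau)\in C^\infty(\mathbb{R}^n)\times\mathbb{R}_+:\int_{\mathbb{R}^n}(4\pi\tau)^{-n/2}e^{-\phi}\,\mathrm{dvol}=1\}$. The weighted elementary symmetric polynomials $\sigma_k^\infty\colon\mathbb{R}\times\mathbb{R}^n\to\mathbb{R}$ are defined recursively by $\sigma_0^\infty=1$ and, for $k\ge1$, $$k\,\sigma_k^\infty(\mu_0;\mu)=\sigma_{k-1}^\infty(\mu_0;\mu)\sum_{j=0}^n\mu_j+\sum_{i=1}^{k-1}\sum_{j=1}^n(-1)^i\sigma_{k-1-i}^\infty(\mu_0;\mu)\,\mu_j^{i+1}.$$ For a symmetric matrix (or self-adjoint endomorphism) $P$, $\sigma_k^\infty(\mu_0;P):=\sigma_k^\infty(\mu_0;\mu)$ with $\mu$ the eigenvalues of $P$. On $(\mathbb{R}^n,dx^2)$ with $\phi\in C^\infty(\mathbb{R}^n)$ and $\lambda=\frac1{2\tau}$: $\widetilde{\operatorname{Ric}}_\phi:=\nabla^2\phi-\lambda\,dx^2$, $\widetilde{Y}_\phi:=-\frac12\left(|\nabla\phi|^2-2\lambda\phi\right)$, $$\widehat{\sigma}_{j,\phi}:=\sigma_j^\infty\left(\widetilde{Y}_\phi-\lambda;\widetilde{\operatorname{Ric}}_\phi\right),\qquad \widehat{E}_{k,\phi}:=\sum_{j=1}^k(-1)^j\,\widehat{\sigma}_{k-j,\phi}\,(\widetilde{\operatorname{Ric}}_\phi)^j,$$ where $(\widetilde{\operatorname{Ric}}_\phi)^j$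 is the $j$-fold composition as an endomorphism. *)

theory Defs
  imports "HOL-Analysis.Analysis"
begin

text \<open>Functions on \<open>real^'n\<close> of class \<open>C^k\<close>: all iterated partial derivatives up to order \<open>k\<close>
  exist as continuous functions. (Differentiability is total; for \<open>k \<ge> 1\<close> this is the usual
  class since continuous partial derivatives imply it.)\<close>

primrec Ck :: "nat \<Rightarrow> (real^'n \<Rightarrow> real) \<Rightarrow> bool" where
  "Ck 0 f \<longleftrightarrow> continuous_on UNIV f"
| "Ck (Suc k) f \<longleftrightarrow> f differentiable_on UNIV \<and>
     (\<forall>i. Ck k (\<lambda>x. frechet_derivative f (at x) (axis i 1)))"

definition smooth :: "(real^'n \<Rightarrow> real) \<Rightarrow> bool" where
  "smooth f \<longleftrightarrow> (\<forall>k. Ck k f)"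

text \<open>The integral over Lebesgue measure; \<open>has_bochner_integral\<close> includes integrability.\<close>

definition C1_space :: "((real^'n \<Rightarrow> real) \<times> real) set" where
  "C1_space = {(\<phi>, \<tau>). smooth \<phi> \<and> \<tau> > 0 \<and>
     has_bochner_integral lborel
       (\<lambda>x. (4 * pi * \<tau>) powr (- real CARD('n) / 2) * exp (- \<phi> x)) 1}"

text \<open>The index \<open>j = 0\<close> of the weighted polynomials is the separate argument \<open>\<mu>\<^sub>0\<close>.\<close>

fun sigma_inf :: "nat \<Rightarrow> real \<Rightarrow> real^'n \<Rightarrow> real" where
  "sigma_inf 0 \<mu>\<^sub>0 \<mu> = 1"
| "sigma_inf (Suc k) \<mu>\<^sub>0 \<mu> =
     (sigma_inf k \<mu>\<^sub>0 \<mu> * (\<mu>\<^sub>0 + (\<Sum>j\<in>UNIV. \<mu> $ j))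
      + (\<Sum>i=1..k. \<Sum>j\<in>UNIV. (-1) ^ i * sigma_inf (k - i) \<mu>\<^sub>0 \<mu> * (\<mu> $ j) ^ (i + 1)))
     / real (Suc k)"

lemma sigma_inf_recursion:
  fixes \<mu> :: "real^'n"
  assumes "k \<ge> 1"
  shows "real k * sigma_inf k \<mu>\<^sub>0 \<mu> =
     sigma_inf (k - 1) \<mu>\<^sub>0 \<mu> * (\<mu>\<^sub>0 + (\<Sum>j\<in>UNIV. \<mu> $ j))
     + (\<Sum>i=1..k-1. \<Sum>j\<in>UNIV. (-1) ^ i * sigma_inf (k - 1 - i) \<mu>\<^sub>0 \<mu> * (\<mu> $ j) ^ (i + 1))"
  using assms by (cases k) auto

text \<open>The entries of \<open>\<mu>\<close> are the eigenvalues of \<open>P\<close> with algebraic multiplicity, i.e. the roots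
  of the characteristic polynomial. For symmetric \<open>P\<close> such a real \<open>\<mu>\<close> exists and is unique
  up to permuting its entries.\<close>

definition eigenvalues :: "real^'n^'n \<Rightarrow> real^'n \<Rightarrow> bool" where
  "eigenvalues P \<mu> \<longleftrightarrow> (\<forall>t. det (mat t - P) = (\<Prod>j\<in>UNIV. t - \<mu> $ j))"

text \<open>\<open>sigma_inf k \<mu>\<^sub>0\<close> is symmetric in the entries of \<open>\<mu>\<close>, so the choice of ordering is immaterial.
  Only meaningful for symmetric \<open>P\<close>.\<close>

definition sigma_inf_mat :: "nat \<Rightarrow> real \<Rightarrow> real^'n^'n \<Rightarrow> real" where
  "sigma_inf_mat k \<mu>\<^sub>0 P = sigma_inf k \<mu>\<^sub>0 (SOME \<mu>. eigenvalues P \<mu>)"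

definition mpow :: "real^'n^'n \<Rightarrow> nat \<Rightarrow> real^'n^'n" where
  "mpow P j = (((**) P) ^^ j) (mat 1)"

definition grad :: "(real^'n \<Rightarrow> real) \<Rightarrow> real^'n \<Rightarrow> real^'n" where
  "grad \<phi> x = (\<chi> i. frechet_derivative \<phi> (at x) (axis i 1))"

definition hessian :: "(real^'n \<Rightarrow> real) \<Rightarrow> real^'n \<Rightarrow> real^'n^'n" where
  "hessian \<phi> x = jacobian (grad \<phi>) (at x)"

definition Ric_tilde :: "real \<Rightarrow> (real^'n \<Rightarrow> real) \<Rightarrow> real^'n \<Rightarrow> real^'n^'n" where
  "Ric_tilde lam \<phi> x = hessian \<phi> x - mat lam"

definition Y_tilde :: "real \<Rightarrow> (real^'n \<Rightarrow> real) \<Rightarrow> real^'n \<Rightarrow> real" where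
  "Y_tilde lam \<phi> x = - (1/2) * ((norm (grad \<phi> x))\<^sup>2 - 2 * lam * \<phi> x)"

definition sigma_hat :: "real \<Rightarrow> nat \<Rightarrow> (real^'n \<Rightarrow> real) \<Rightarrow> real^'n \<Rightarrow> real" where
  "sigma_hat lam j \<phi> x = sigma_inf_mat j (Y_tilde lam \<phi> x - lam) (Ric_tilde lam \<phi> x)"

definition E_hat :: "real \<Rightarrow> nat \<Rightarrow> (real^'n \<Rightarrow> real) \<Rightarrow> real^'n \<Rightarrow> real^'n^'n" where
  "E_hat lam k \<phi> x =
     (\<Sum>j=1..k. ((-1) ^ j * sigma_hat lam (k - j) \<phi> x) *\<^sub>R mpow (Ric_tilde lam \<phi> x) j)"

end

theory Submission
  imports Defs "HOL-Probability.Probability" "HOL-Computational_Algebra.Fundamental_Theorem_Algebra"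
begin

text \<open>Write \<open>P = \<nabla>\<^sup>2\<phi> - \<lambda>\<close>, \<open>m\<^sub>0 = Y - \<lambda>\<close> and \<open>T(k) = \<Sum> (-1)^l \<sigma>(k-l) P\<^sup>l\<close>, so that \<open>E(k) = - P T(k-1)\<close>.
  Since \<open>P\<close> is a Codazzi tensor, \<open>div T(k) = T(k-1) \<nabla>m\<^sub>0\<close>; since \<open>\<nabla>m\<^sub>0 = - P \<nabla>\<phi>\<close>, the tensor \<open>exp(-\<phi>) E(k)\<close> is divergence free
  when \<open>\<sigma>(k)\<close> is constant. The hypothesis at infinity gives Gaussian decay of \<open>exp(-\<phi>)\<close> and polynomial
  bounds on the derivatives of \<open>\<phi>\<close>, so pairing with \<open>\<nabla>\<phi>\<close> and integrating by parts yields
  \<open>\<integral> tr (T(k-1) P\<^sup>2) exp(-\<phi>) = 0\<close>. The generating function of the \<open>\<sigma>(j)\<close> is \<open>exp(at) p(t)\<close> with \<open>p\<close> real-rooted,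
  so Newton's inequalities hold, and as for the Garding cones the sign conditions make
  \<open>(-1)^(k-1) T(k-1)\<close> positive definite. Hence \<open>P = 0\<close>, \<open>\<phi>\<close> is quadratic, and the normalization of the
  integral determines the additive constant.\<close>

section \<open>Newton inequalities for real-rooted polynomials\<close>

text \<open>Two obstacles shape the proof. First, \<open>sigma_inf_mat\<close> reads its value off a
  chosen list of eigenvalues, which need not vary smoothly where eigenvalues collide. The calculus
  therefore runs on \<open>sigma_tr\<close>, a polynomial in \<open>m0\<close> and the traces of the
  powers of \<open>P\<close>, and eigenbases are used only pointwise, to decide signs. Second, the
  condition at infinity controls \<phi> only up to second derivatives, while the divergence of a
  Newton tensor contains third ones. They have to cancel identically before anything is estimated;
  only then does the integrand have a Gaussian majorant that allows a cutoff to be removed. The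
  exponential in the generating function arises because \<open>m0\<close> acts like N eigenvalues
  \<open>m0 / N\<close> in the limit of large N: \<open>(1 + m0 t / N)^N\<close> tends to
  \<open>exp (m0 t)\<close>. Newton's inequalities survive the limit because
  \<open>q \<mapsto> a q + q'\<close> preserves real-rootedness.\<close>

inductive real_rooted :: "real poly \<Rightarrow> bool" where
  const: "real_rooted [:c:]"
| linear_mult: "real_rooted p \<Longrightarrow> real_rooted ([:-r, 1:] * p)"

lemma real_rooted_smult: "real_rooted p \<Longrightarrow> real_rooted (smult c p)"
proof (induction rule: real_rooted.induct)
  case (const d)
  then show ?case by (simp add: real_rooted.const)
next
  case (linear_mult p r)
  then show ?case
    using real_rooted.linear_mult[OF linear_mult.IH, of r] by (metis mult_smult_right)
qed

lemma real_rooted_linear_mult': "real_rooted p \<Longrightarrow> real_rooted ([:1, m:] * p)"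
proof (cases "m = 0")
  case True
  assume "real_rooted p" with True show ?thesis by (simp add: one_pCons[symmetric])
next
  case False
  assume p: "real_rooted p"
  have "[:1, m:] * p = [:- (-1/m), 1:] * smult m p"
    using False by (simp add: smult_add_right)
  with real_rooted.linear_mult[OF real_rooted_smult[OF p], of "-1/m" m] show ?thesis by metis
qed

lemma real_rooted_prod_linear:
  assumes "finite A"
  shows "real_rooted (\<Prod>j\<in>A. [:1, m j:])"
  using assms
proof (induction rule: finite_induct)
  case empty
  then show ?case by (simp add: one_pCons real_rooted.const)
next
  case (insert x F)
  then show ?case using real_rooted_linear_mult'[of "\<Prod>j\<in>F. [:1, m j:]" "m x"] by simp
qed

text \<open>Where p does not vanish this says that (log |p|)'' is nonpositive. In the induction a
  new factor x - r turns D = p'^2 - p p'' into p^2 + (x - r)^2 D, which is again nonnegative; this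
  form has no division by p.\<close>

lemma real_rooted_laguerre:
  "real_rooted p \<Longrightarrow> poly p x * poly (pderiv (pderiv p)) x \<le> (poly (pderiv p) x)\<^sup>2"
proof (induction rule: real_rooted.induct)
  case (const c)
  then show ?case by (simp add: pderiv_pCons)
next
  case (linear_mult p r)
  let ?d = "(x - r)"
  have 1: "poly ([:- r, 1:] * p) x = ?d * poly p x" by (simp add: algebra_simps)
  have 2: "poly (pderiv ([:- r, 1:] * p)) x = poly p x + ?d * poly (pderiv p) x"
    unfolding pderiv_mult by (simp add: pderiv_pCons algebra_simps)
  have 3: "poly (pderiv (pderiv ([:- r, 1:] * p))) x = 2 * poly (pderiv p) x + ?d * poly (pderiv (pderiv p)) x"
    unfolding pderiv_mult pderiv_add by (simp add: pderiv_pCons algebra_simps)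
  have "(poly p x + ?d * poly (pderiv p) x)\<^sup>2 - (?d * poly p x) * (2 * poly (pderiv p) x + ?d * poly (pderiv (pderiv p)) x)
    = (poly p x)\<^sup>2 + ?d\<^sup>2 * ((poly (pderiv p) x)\<^sup>2 - poly p x * poly (pderiv (pderiv p)) x)"
    by (simp add: power2_eq_square algebra_simps)
  moreover have "\<dots> \<ge> 0" using linear_mult.IH by (intro add_nonneg_nonneg mult_nonneg_nonneg) auto
  ultimately show ?case unfolding 1 2 3 by linarith
qed

text \<open>Each root \<open>r\<close> contributes \<open>1 / (z - r)\<close> to the logarithmic derivative, whose imaginary part
  has the sign opposite to that of \<open>Im z\<close>.\<close>
lemma real_rooted_log_deriv:
  assumes "real_rooted p" "p \<noteq> 0" "Im z \<noteq> 0"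
  shows "poly (map_poly of_real p) z \<noteq> 0 \<and>
    Im z * Im (poly (map_poly of_real (pderiv p)) z / poly (map_poly of_real p) z) \<le> 0 \<and>
    (degree p > 0 \<longrightarrow> Im z * Im (poly (map_poly of_real (pderiv p)) z / poly (map_poly of_real p) z) < 0)"
  using assms(1,2)
proof (induction rule: real_rooted.induct)
  case (const c)
  then show ?case by (simp add: map_poly_pCons pderiv_pCons)
next
  case (linear_mult p r)
  let ?c = "map_poly complex_of_real"
  have p0: "p \<noteq> 0" using linear_mult by auto
  note IH = linear_mult.IH[OF p0]
  have hom: "?c (a * b) = ?c a * ?c b" for a b
    by (rule poly_eqI) (simp add: coeff_map_poly coeff_mult)
  have homa: "?c (a + b) = ?c a + ?c b" for a b
    by (rule poly_eqI) (simp add: coeff_map_poly)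
  have lin: "?c [:- r, 1:] = [:- of_real r, 1:]" by (simp add: map_poly_pCons)
  have zr: "z - of_real r \<noteq> 0" using assms(3) by (metis Im_complex_of_real eq_iff_diff_eq_0)
  have 1: "poly (?c ([:- r, 1:] * p)) z = (z - of_real r) * poly (?c p) z"
    unfolding hom lin by (simp add: algebra_simps)
  have 2: "poly (?c (pderiv ([:- r, 1:] * p))) z = poly (?c p) z + (z - of_real r) * poly (?c (pderiv p)) z"
    unfolding pderiv_mult homa hom lin by (simp add: pderiv_pCons map_poly_pCons algebra_simps)
  have quot: "poly (?c (pderiv ([:- r, 1:] * p))) z / poly (?c ([:- r, 1:] * p)) z
     = 1 / (z - of_real r) + poly (?c (pderiv p)) z / poly (?c p) z"
    unfolding 1 2 using zr IH by (simp add: field_simps)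
  have "Im z * Im (1 / (z - of_real r)) = - ((Im z)\<^sup>2 / (cmod (z - of_real r))\<^sup>2)"
    by (simp add: Im_divide cmod_power2 flip: power2_eq_square)
  also have "\<dots> < 0" using zr assms(3) by simp
  finally have neg: "Im z * Im (1 / (z - of_real r)) < 0" .
  have "Im z * Im (poly (?c (pderiv ([:- r, 1:] * p))) z / poly (?c ([:- r, 1:] * p)) z) < 0"
    unfolding quot using neg IH by (simp add: distrib_left del: of_real_eq_iff)
  then show ?case using 1 zr IH by auto
qed

text \<open>Any complex root must be real, so it splits off a real linear factor, and the cofactor
  inherits the hypothesis.\<close>

lemma real_rooted_if_no_nonreal_roots:
  assumes "\<And>z. Im z \<noteq> 0 \<Longrightarrow> poly (map_poly complex_of_real p) z \<noteq> 0"
  shows "real_rooted p"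
  using assms
proof (induction "degree p" arbitrary: p)
  case 0
  then obtain c where "p = [:c:]" by (metis degree_eq_zeroE)
  then show ?case by (simp add: real_rooted.const)
next
  case (Suc n)
  have deg: "degree (map_poly complex_of_real p) = degree p" by (rule degree_map_poly) simp
  have "\<not> constant (poly (map_poly complex_of_real p))"
    using Suc.hyps deg by (simp add: constant_degree)
  then obtain z where z: "poly (map_poly complex_of_real p) z = 0"
    using fundamental_theorem_of_algebra by blast
  then have "Im z = 0" using Suc.prems by blast
  then obtain r where r: "z = of_real r" by (metis complex_is_Real_iff Reals_cases)
  have hom: "map_poly complex_of_real (a * b) = map_poly complex_of_real a * map_poly complex_of_real b" for a b
    by (rule poly_eqI) (simp add: coeff_map_poly coeff_mult)
  have ev: "poly (map_poly complex_of_real p) (of_real r) = of_real (poly p r)" for p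
    by (induction p) (simp_all add: map_poly_pCons)
  have "poly p r = 0" using z ev unfolding r by (metis of_real_eq_0_iff)
  then obtain q where q: "p = [:-r, 1:] * q" by (metis dvdE poly_eq_0_iff_dvd)
  have "q \<noteq> 0" using q Suc.hyps by auto
  then have dq: "degree p = Suc (degree q)" unfolding q by (subst degree_mult_eq) auto
  have "real_rooted q"
  proof (rule Suc.hyps)
    show "n = degree q" using dq Suc.hyps by simp
    show "poly (map_poly complex_of_real q) z \<noteq> 0" if "Im z \<noteq> 0" for z
      using Suc.prems[OF that] unfolding q hom by auto
  qed
  then show ?case unfolding q by (rule real_rooted.linear_mult)
qed

text \<open>Off the real axis a p + p' = p (a + p'/p), and for nonconstant p the quotient p'/p has
  nonzero imaginary part, so it cannot equal the real number -a. Arguing with nonreal points avoids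
  counting multiplicities as a proof by Rolle's theorem would.\<close>

lemma real_rooted_exp_deriv:
  assumes "real_rooted p"
  shows "real_rooted (smult a p + pderiv p)"
proof (cases "degree p = 0")
  case True
  then obtain c where "p = [:c:]" by (metis degree_eq_zeroE)
  then show ?thesis by (simp add: pderiv_pCons real_rooted.const)
next
  case False
  then have p0: "p \<noteq> 0" by auto
  show ?thesis
  proof (rule real_rooted_if_no_nonreal_roots)
    fix z :: complex assume z: "Im z \<noteq> 0"
    let ?c = "map_poly complex_of_real"
    have eq: "poly (?c (smult a p + pderiv p)) z = of_real a * poly (?c p) z + poly (?c (pderiv p)) z"
    proof -
      have "?c (smult a p + pderiv p) = smult (of_real a) (?c p) + ?c (pderiv p)"
        by (rule poly_eqI) (simp add: coeff_map_poly)
      then show ?thesis by simp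
    qed
    note L = real_rooted_log_deriv[OF assms p0 z]
    show "poly (?c (smult a p + pderiv p)) z \<noteq> 0"
    proof
      assume "poly (?c (smult a p + pderiv p)) z = 0"
      then have "poly (?c (pderiv p)) z / poly (?c p) z = - of_real a"
        unfolding eq using L by (simp add: field_simps add_eq_0_iff)
      then show False using L False by simp
    qed
  qed
qed

lemma fps_deriv_exp_mult_poly:
  "fps_deriv (fps_exp a * fps_of_poly p) = fps_exp a * fps_of_poly (smult a p + pderiv p)" for a :: real
  by (simp add: fps_of_poly_add fps_of_poly_smult fps_of_poly_pderiv algebra_simps)

lemma fps_nth_exp_mult_poly:
  "fps_nth (fps_exp a * fps_of_poly p) m = poly (((\<lambda>q. smult a q + pderiv q) ^^ m) p) 0 / fact m" for a :: real
proof -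
  have "(fps_deriv ^^ m) (fps_exp a * fps_of_poly p) = fps_exp a * fps_of_poly (((\<lambda>q. smult a q + pderiv q) ^^ m) p)"
    by (induction m) (simp_all only: funpow.simps id_apply o_apply fps_deriv_exp_mult_poly)
  moreover have "fps_nth ((fps_deriv ^^ m) f) 0 = fact m * fps_nth f m" for f :: "real fps"
    by (rule fps_0th_higher_deriv)
  moreover have "fps_nth (fps_exp a * fps_of_poly q) 0 = poly q 0" for q :: "real poly"
    by (simp add: fps_mult_nth poly_0_coeff_0)
  ultimately show ?thesis by (metis fact_nonzero nonzero_mult_div_cancel_left)
qed

text \<open>The m-th coefficient is (D^m p)(0) / m! with D = a + d/dx. Since D^m p is real-rooted,
  the inequality is Laguerre's at 0; the shift by a drops out of c1^2 - c0 c2.\<close>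

lemma real_rooted_newton:
  fixes a :: real
  assumes "real_rooted p"
  defines "s \<equiv> fps_nth (fps_exp a * fps_of_poly p)"
  shows "s m * s (Suc (Suc m)) \<le> (s (Suc m))\<^sup>2"
proof -
  define D where "D = (\<lambda>q::real poly. smult a q + pderiv q)"
  define q where "q = (D ^^ m) p"
  have rq: "real_rooted q"
    unfolding q_def by (induction m) (auto simp: D_def assms(1) intro: real_rooted_exp_deriv)
  define c0 c1 c2 where "c0 = poly q 0" and "c1 = poly (D q) 0" and "c2 = poly (D (D q)) 0"
  have "c1\<^sup>2 - c0 * c2 = (poly (pderiv q) 0)\<^sup>2 - poly q 0 * poly (pderiv (pderiv q)) 0"
    unfolding c0_def c1_def c2_def D_def by (simp add: pderiv_add pderiv_smult power2_eq_square algebra_simps)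
  then have lag: "c0 * c2 \<le> c1\<^sup>2" using real_rooted_laguerre[OF rq, of 0] by linarith
  have s: "s m = c0 / fact m" "s (Suc m) = c1 / fact (Suc m)" "s (Suc (Suc m)) = c2 / fact (Suc (Suc m))"
    unfolding s_def fps_nth_exp_mult_poly c0_def c1_def c2_def q_def D_def by simp_all
  \<comment> \<open>The factor (m+1)/(m+2) is (m+1)!^2 / (m! (m+2)!). Being at most 1 it weakens the
    inequality when c0 c2 is positive; otherwise the left side is nonpositive anyway.\<close>
  have "c0 * c2 * (real (Suc m) / real (Suc (Suc m))) \<le> c1\<^sup>2"
  proof (cases "c0 * c2 \<le> 0")
    case True
    then have "c0 * c2 * (real (Suc m) / real (Suc (Suc m))) \<le> 0"
      by (rule mult_nonpos_nonneg) auto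
    then show ?thesis by (smt (verit) zero_le_power2)
  next
    case False
    have "c0 * c2 * (real (Suc m) / real (Suc (Suc m))) \<le> c0 * c2 * 1"
      using False by (intro mult_left_mono) auto
    then show ?thesis using lag by linarith
  qed
  then have "c0 * c2 * (real (Suc m) / real (Suc (Suc m))) / (fact (Suc m))\<^sup>2 \<le> c1\<^sup>2 / (fact (Suc m))\<^sup>2"
    by (intro divide_right_mono) auto
  also have "c0 * c2 * (real (Suc m) / real (Suc (Suc m))) / (fact (Suc m))\<^sup>2 = s m * s (Suc (Suc m))"
    unfolding s by (simp add: power2_eq_square divide_simps fact_reduce del: of_nat_Suc)
  finally show ?thesis unfolding s by (simp add: power_divide)
qed

text \<open>Here \<open>t'\<close> is \<open>t\<close> with the eigenvalue \<nu> removed. If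
  \<open>t' (Suc j)\<close> were the first nonpositive term, positivity of \<open>t (Suc j)\<close>
  would force \<nu> > 0 and \<nu> \<open>t' j\<close> > - \<open>t' (Suc j)\<close>; positivity of
  \<open>t (Suc (Suc j))\<close> would then make \<open>t' j * t' (Suc (Suc j))\<close> exceed
  \<open>(t' (Suc j))^2\<close>, against Newton. The argument looks one index ahead, so one positive
  term is lost.\<close>

lemma garding_cone_drop:
  fixes t t' :: "nat \<Rightarrow> real"
  assumes t'0: "t' 0 = 1"
    and rec: "\<And>j. t (Suc j) = t' (Suc j) + \<nu> * t' j"
    and newton: "\<And>j. t' j * t' (Suc (Suc j)) \<le> (t' (Suc j))\<^sup>2"
    and pos: "\<And>j. 1 \<le> j \<Longrightarrow> j \<le> k \<Longrightarrow> t j > 0"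
  shows "j < k \<Longrightarrow> t' j > 0"
proof (induction j)
  case 0
  then show ?case using t'0 by simp
next
  case (Suc j)
  then have IH: "t' j > 0" by simp
  have p1: "t' (Suc j) + \<nu> * t' j > 0" using rec[of j] pos[of "Suc j"] Suc.prems by simp
  have p2: "t' (Suc (Suc j)) + \<nu> * t' (Suc j) > 0" using rec[of "Suc j"] pos[of "Suc (Suc j)"] Suc.prems by simp
  show ?case
  proof (rule ccontr)
    assume neg: "\<not> t' (Suc j) > 0"
    then have nu: "\<nu> > 0" using p1 IH by (smt (verit) mult_nonneg_nonneg mult_nonpos_nonneg)
    have "(t' (Suc j))\<^sup>2 = (- t' (Suc j)) * (- t' (Suc j))" by (simp add: power2_eq_square)
    also have "\<dots> \<le> (- t' (Suc j)) * (\<nu> * t' j)" using p1 neg by (intro mult_left_mono) auto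
    also have "\<dots> = t' j * (- \<nu> * t' (Suc j))" by simp
    also have "\<dots> < t' j * t' (Suc (Suc j))" using p2 IH by (intro mult_strict_left_mono) auto
    finally show False using newton[of j] by linarith
  qed
qed

section \<open>Generating function of the weighted elementary symmetric polynomials\<close>

definition sym_fps :: "real \<Rightarrow> ('i \<Rightarrow> real) \<Rightarrow> 'i set \<Rightarrow> real fps" where
  "sym_fps m0 \<mu> A = fps_exp m0 * fps_of_poly (\<Prod>j\<in>A. [:1, \<mu> j:])"

definition geo_fps :: "real \<Rightarrow> real fps" where
  "geo_fps m = Abs_fps (\<lambda>i. (- m) ^ i)"

lemma geo_fps_inverse: "fps_of_poly [:1, m:] * geo_fps m = 1"
proof (rule fps_ext)
  fix n
  have "fps_of_poly [:1, m:] = 1 + fps_const m * fps_X"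
    by (simp add: fps_of_poly_pCons)
  from arg_cong[OF this, of "\<lambda>F. fps_nth (F * geo_fps m) n"]
  show "fps_nth (fps_of_poly [:1, m:] * geo_fps m) n = fps_nth 1 n"
    by (cases n) (simp_all add: geo_fps_def distrib_right mult.assoc)
qed

lemma sym_fps_insert:
  assumes "finite A" "i \<notin> A"
  shows "sym_fps m0 \<mu> (insert i A) = fps_of_poly [:1, \<mu> i:] * sym_fps m0 \<mu> A"
  using assms by (simp add: sym_fps_def fps_of_poly_mult mult_ac del: mult_pCons_left mult_pCons_right)

text \<open>The logarithmic derivative m0 + \<Sum> \<mu>_j / (1 + \<mu>_j t), multiplied out, with
  each quotient expanded as a geometric series.\<close>

lemma fps_deriv_sym_fps:
  assumes "finite A"
  shows "fps_deriv (sym_fps m0 \<mu> A) =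
    sym_fps m0 \<mu> A * (fps_const m0 + (\<Sum>j\<in>A. fps_const (\<mu> j) * geo_fps (\<mu> j)))"
  using assms
proof (induction rule: finite_induct)
  case empty
  then show ?case by (simp add: sym_fps_def)
next
  case (insert i A)
  define L where "L = fps_const m0 + (\<Sum>j\<in>A. fps_const (\<mu> j) * geo_fps (\<mu> j))"
  define F where "F = fps_of_poly [:1, \<mu> i:]"
  have F': "fps_deriv F = fps_const (\<mu> i)"
    unfolding F_def fps_of_poly_pderiv[symmetric] by (simp add: pderiv_pCons fps_of_poly_pCons)
  have FG: "F * geo_fps (\<mu> i) = 1" unfolding F_def by (rule geo_fps_inverse)
  have "fps_deriv (F * sym_fps m0 \<mu> A) = fps_const (\<mu> i) * sym_fps m0 \<mu> A + F * (sym_fps m0 \<mu> A * L)"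
    using insert.IH by (simp add: F' L_def)
  \<comment> \<open>The inserted factor is 1; it allows \<open>F * sym_fps\<close> to be pulled out
    of both summands.\<close>
  also have "\<dots> = (F * geo_fps (\<mu> i)) * (fps_const (\<mu> i) * sym_fps m0 \<mu> A) + F * (sym_fps m0 \<mu> A * L)"
    unfolding FG by simp
  also have "\<dots> = F * sym_fps m0 \<mu> A * (L + fps_const (\<mu> i) * geo_fps (\<mu> i))"
    by (simp add: algebra_simps)
  finally show ?case
    using insert.hyps by (simp add: sym_fps_insert F_def[symmetric] L_def add_ac)
qed

lemma fps_nth_sym_fps_0: "finite A \<Longrightarrow> fps_nth (sym_fps m0 \<mu> A) 0 = 1"
proof (induction rule: finite_induct)
  case (insert i A)
  then show ?case by (simp add: sym_fps_insert)
qed (simp add: sym_fps_def)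

text \<open>The defining recursion is the coefficient form of S' = L S. The coefficients of L are
  the signed power sums, and \<open>m0\<close> enters only the one of index 0, matching the inner
  sum of the recursion, which starts at j = 1.\<close>

lemma sigma_inf_eq_fps_nth: "sigma_inf k m0 \<mu> = fps_nth (sym_fps m0 (($) \<mu>) UNIV) k"
proof (induction k rule: less_induct)
  case (less k)
  show ?case
  proof (cases k)
    case 0
    then show ?thesis by (simp add: fps_nth_sym_fps_0)
  next
    case (Suc n)
    let ?S = "sym_fps m0 (($) \<mu>) UNIV"
    let ?L = "fps_const m0 + (\<Sum>j\<in>UNIV. fps_const (\<mu> $ j) * geo_fps (\<mu> $ j))"
    have L0: "fps_nth ?L 0 = m0 + (\<Sum>j\<in>UNIV. \<mu> $ j)"
      by (simp add: geo_fps_def fps_sum_nth)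
    have L: "fps_nth ?L i = (\<Sum>j\<in>UNIV. (-1) ^ i * (\<mu> $ j) ^ (i + 1))" if "i > 0" for i
      using that by (simp add: geo_fps_def fps_sum_nth power_minus[of "_ $ _"] mult_ac)
    have IH: "fps_nth ?S m = sigma_inf m m0 \<mu>" if "m \<le> n" for m
      using less.IH[of m] that Suc by simp
    have "real (Suc n) * fps_nth ?S (Suc n) = fps_nth (fps_deriv ?S) n" by simp
    also have "\<dots> = fps_nth (?L * ?S) n" by (simp add: fps_deriv_sym_fps mult.commute)
    also have "\<dots> = (\<Sum>i=0..n. fps_nth ?L i * sigma_inf (n - i) m0 \<mu>)"
      unfolding fps_mult_nth using IH by (intro sum.cong) auto
    also have "\<dots> = fps_nth ?L 0 * sigma_inf n m0 \<mu> + (\<Sum>i=1..n. fps_nth ?L i * sigma_inf (n - i) m0 \<mu>)"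
      by (subst sum.atLeast_Suc_atMost) auto
    also have "(\<Sum>i=1..n. fps_nth ?L i * sigma_inf (n - i) m0 \<mu>)
       = (\<Sum>i=1..n. \<Sum>j\<in>UNIV. (-1) ^ i * sigma_inf (n - i) m0 \<mu> * (\<mu> $ j) ^ (i + 1))"
      by (intro sum.cong refl) (simp add: L sum_distrib_right sum_distrib_left mult_ac del: fps_add_nth)
    finally have "sigma_inf (Suc n) m0 \<mu> = real (Suc n) * fps_nth ?S (Suc n) / real (Suc n)"
      unfolding L0 sigma_inf.simps by (simp only: mult.commute)
    then show ?thesis unfolding Suc by (simp del: sigma_inf.simps)
  qed
qed

text \<open>The sum is the eigenvalue of the n-th Newton tensor on the i-th eigenvector. It is also
  the n-th coefficient of the generating function divided by 1 + \<mu>_i t, that is, with the i-th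
  eigenvalue removed, so the cone argument applies to it.\<close>

lemma sigma_inf_drop_pos:
  fixes \<mu> :: "real^'n"
  assumes pos: "\<And>j. j \<in> {1..Suc n} \<Longrightarrow> (-1) ^ j * sigma_inf j m0 \<mu> > 0"
  shows "(-1) ^ n * (\<Sum>l\<le>n. (-1) ^ l * sigma_inf (n - l) m0 \<mu> * (\<mu> $ i) ^ l) > 0"
proof -
  let ?S = "sym_fps m0 (($) \<mu>) UNIV" and ?S' = "sym_fps m0 (($) \<mu>) (UNIV - {i})"
  have S: "?S = fps_of_poly [:1, \<mu> $ i:] * ?S'"
    using sym_fps_insert[of "UNIV - {i}" i m0 "($) \<mu>"] by (simp add: insert_UNIV)
  have step: "fps_nth ?S (Suc j) = fps_nth ?S' (Suc j) + \<mu> $ i * fps_nth ?S' j" for j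
    unfolding S by (simp add: fps_of_poly_pCons distrib_right mult.assoc)
  have "?S' = geo_fps (\<mu> $ i) * ?S"
    unfolding S mult.assoc[symmetric] by (simp add: mult.commute[of "geo_fps _"] geo_fps_inverse)
  then have "fps_nth ?S' n = fps_nth (geo_fps (\<mu> $ i) * ?S) n" by simp
  also have "\<dots> = (\<Sum>l\<le>n. (-1) ^ l * sigma_inf (n - l) m0 \<mu> * (\<mu> $ i) ^ l)"
    unfolding fps_mult_nth geo_fps_def sigma_inf_eq_fps_nth atMost_atLeast0 fps_nth_Abs_fps
    by (simp only: power_minus[of "_ $ _"] mult_ac)
  finally have S': "fps_nth ?S' n = (\<Sum>l\<le>n. (-1) ^ l * sigma_inf (n - l) m0 \<mu> * (\<mu> $ i) ^ l)" .
  define t' where "t' = (\<lambda>j. (-1) ^ j * fps_nth ?S' j)"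
  have rr: "real_rooted (\<Prod>j\<in>UNIV - {i}. [:1, \<mu> $ j:])" by (rule real_rooted_prod_linear) simp
  have "t' n > 0"
  \<comment> \<open>The signs (-1)^j amount to replacing t by -t in the generating function, so the
    eigenvalue removed is - \<mu>_i.\<close>
  proof (rule garding_cone_drop[where t = "\<lambda>j. (-1) ^ j * sigma_inf j m0 \<mu>" and \<nu> = "- \<mu> $ i" and k = "Suc n"])
    show "t' 0 = 1" by (simp add: t'_def fps_nth_sym_fps_0)
    show "(-1) ^ Suc j * sigma_inf (Suc j) m0 \<mu> = t' (Suc j) + - \<mu> $ i * t' j" for j
      unfolding sigma_inf_eq_fps_nth step t'_def by (simp add: algebra_simps)
    show "t' j * t' (Suc (Suc j)) \<le> (t' (Suc j))\<^sup>2" for j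
    proof -
      have "t' j * t' (Suc (Suc j)) = fps_nth ?S' j * fps_nth ?S' (Suc (Suc j)) * ((-1) ^ j * (-1) ^ j)"
        by (simp add: t'_def mult_ac)
      also have "\<dots> \<le> (fps_nth ?S' (Suc j))\<^sup>2"
        using real_rooted_newton[OF rr, of m0 j] unfolding sym_fps_def
        by (simp add: power_mult_distrib[symmetric])
      also have "\<dots> = (t' (Suc j))\<^sup>2" by (simp add: t'_def minus_one_power_iff)
      finally show ?thesis .
    qed
  qed (use pos in auto)
  then show ?thesis unfolding t'_def S' .
qed

section \<open>Diagonalization of symmetric matrices\<close>

text \<open>The first-order condition at a maximum, in a form that avoids differentiating.\<close>

lemma linear_bounded_by_square_imp_0:
  fixes c M :: real
  assumes "\<And>t. 2 * t * c \<le> t\<^sup>2 * M"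
  shows "c = 0"
proof (rule ccontr)
  assume c: "c \<noteq> 0"
  define N where "N = \<bar>M\<bar> + 1"
  have N: "N > 0" "M \<le> N" by (auto simp: N_def)
  \<comment> \<open>The point t = c / N maximizes 2 t c - t^2 N; M was enlarged to a positive N to
    make it available.\<close>
  have "2 * (c / N) * c \<le> (c / N)\<^sup>2 * N"
    using assms[of "c / N"] mult_left_mono[OF N(2), of "(c / N)\<^sup>2"] by simp
  then have "2 * c\<^sup>2 / N \<le> c\<^sup>2 / N"
    using N by (simp add: power2_eq_square)
  then show False using N c by (simp add: divide_simps)
qed

lemma symmetric_matrix_inner:
  fixes A :: "real^'n^'n"
  assumes "transpose A = A"
  shows "(A *v x) \<bullet> y = x \<bullet> (A *v y)"
  by (metis assms dot_lmul_matrix vector_transpose_matrix)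

text \<open>The vector v maximizes the Rayleigh quotient on the orthogonal complement S of B.
  Perturbing v inside S shows that the residual A v - l v is orthogonal to S. Since B consists of
  eigenvectors, A maps S to itself, so the residual also lies in S and vanishes.\<close>

lemma symmetric_eigenvector_orthogonal:
  fixes A :: "real^'n^'n"
  assumes sym: "transpose A = A"
    and eig: "\<And>b. b \<in> B \<Longrightarrow> \<exists>l. A *v b = l *\<^sub>R b"
    and ex: "\<exists>x. x \<noteq> 0 \<and> (\<forall>b\<in>B. b \<bullet> x = 0)"
  shows "\<exists>v l. norm v = 1 \<and> (\<forall>b\<in>B. b \<bullet> v = 0) \<and> A *v v = l *\<^sub>R v"
proof -
  define S where "S = {x. \<forall>b\<in>B. b \<bullet> x = 0}"
  define f where "f = (\<lambda>x. x \<bullet> (A *v x))"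
  have cl: "closed S"
  proof -
    have "S = (\<Inter>b\<in>B. {x. b \<bullet> x = 0})" by (auto simp: S_def)
    then show ?thesis by (auto intro: closed_hyperplane)
  qed
  have "compact (sphere 0 1 \<inter> S)" using cl by (intro compact_Int_closed) auto
  moreover from ex obtain x where x: "x \<noteq> 0" "x \<in> S" by (auto simp: S_def)
  then have "(1 / norm x) *\<^sub>R x \<in> sphere 0 1 \<inter> S" by (auto simp: S_def)
  moreover have "continuous_on (sphere 0 1 \<inter> S) f"
    unfolding f_def by (intro continuous_intros linear_continuous_on_compose[OF _ matrix_vector_mul_linear, of _ "\<lambda>x. x", simplified])
  ultimately obtain v where v: "v \<in> sphere 0 1 \<inter> S" and max: "\<And>y. y \<in> sphere 0 1 \<inter> S \<Longrightarrow> f y \<le> f v"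
    using continuous_attains_sup[of "sphere 0 1 \<inter> S" f] by blast
  have nv: "norm v = 1" and vS: "v \<in> S" using v by auto
  define l where "l = f v"
  have hom: "f y \<le> l * (y \<bullet> y)" if "y \<in> S" for y
  proof (cases "y = 0")
    case True
    then show ?thesis by (simp add: f_def)
  next
    case False
    have "(1 / norm y) *\<^sub>R y \<in> sphere 0 1 \<inter> S" using that False by (auto simp: S_def)
    from max[OF this] have "f y / (norm y)\<^sup>2 \<le> l"
      by (simp add: f_def l_def matrix_vector_mult_scaleR power2_eq_square)
    then show ?thesis using False by (simp add: divide_simps dot_square_norm mult.commute)
  qed
  have S_comb: "v + t *\<^sub>R w \<in> S" if "w \<in> S" for t w
    using that vS by (auto simp: S_def inner_right_distrib)
  have vv: "v \<bullet> v = 1" using nv by (simp add: dot_square_norm)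
  have orth: "w \<bullet> (A *v v - l *\<^sub>R v) = 0" if w: "w \<in> S" for w
  proof (rule linear_bounded_by_square_imp_0)
    fix t
    have "f (v + t *\<^sub>R w) = l + 2 * t * (w \<bullet> (A *v v)) + t\<^sup>2 * f w"
      using symmetric_matrix_inner[OF sym, of v w]
      by (simp add: f_def l_def matrix_vector_right_distrib matrix_vector_mult_scaleR inner_left_distrib inner_right_distrib
          inner_commute[of v "A *v w"] inner_commute[of w "A *v v"] power2_eq_square algebra_simps)
    moreover have "(v + t *\<^sub>R w) \<bullet> (v + t *\<^sub>R w) = 1 + 2 * t * (w \<bullet> v) + t\<^sup>2 * (w \<bullet> w)"
      using vv by (simp add: inner_left_distrib inner_right_distrib inner_commute[of v w] power2_eq_square algebra_simps)
    ultimately have "l + 2 * t * (w \<bullet> (A *v v)) + t\<^sup>2 * f w \<le> l * (1 + 2 * t * (w \<bullet> v) + t\<^sup>2 * (w \<bullet> w))"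
      using hom[OF S_comb[OF w, of t]] by simp
    then show "2 * t * (w \<bullet> (A *v v - l *\<^sub>R v)) \<le> t\<^sup>2 * (l * (w \<bullet> w) - f w)"
      by (simp add: inner_diff_right algebra_simps)
  qed
  have "A *v v - l *\<^sub>R v \<in> S"
    unfolding S_def
  proof (intro CollectI ballI)
    fix b assume b: "b \<in> B"
    then obtain m where m: "A *v b = m *\<^sub>R b" using eig by blast
    have bv: "b \<bullet> v = 0" using vS b by (auto simp: S_def)
    have "b \<bullet> (A *v v) = (A *v b) \<bullet> v" using symmetric_matrix_inner[OF sym] by simp
    then show "b \<bullet> (A *v v - l *\<^sub>R v) = 0" using bv m by (simp add: inner_diff_right)
  qed
  from orth[OF this] have "A *v v = l *\<^sub>R v" by simp
  with nv vS show ?thesis by (auto simp: S_def)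
qed

lemma symmetric_orthonormal_eigenvectors:
  fixes A :: "real^'n^'n"
  assumes sym: "transpose A = A"
  shows "m \<le> CARD('n) \<Longrightarrow> \<exists>B. finite B \<and> card B = m \<and>
     (\<forall>b\<in>B. norm b = 1 \<and> (\<exists>l. A *v b = l *\<^sub>R b)) \<and> (\<forall>b\<in>B. \<forall>c\<in>B. b \<noteq> c \<longrightarrow> b \<bullet> c = 0)"
proof (induction m)
  case 0
  then show ?case by (intro exI[of _ "{}"]) auto
next
  case (Suc m)
  then obtain B where B: "finite B" "card B = m"
     "\<And>b. b \<in> B \<Longrightarrow> norm b = 1 \<and> (\<exists>l. A *v b = l *\<^sub>R b)"
     "\<And>b c. b \<in> B \<Longrightarrow> c \<in> B \<Longrightarrow> b \<noteq> c \<Longrightarrow> b \<bullet> c = 0" by force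
  have "dim B < DIM(real^'n)" using dim_le_card[of B B] B Suc.prems by (auto simp: span_superset)
  then obtain x where "x \<noteq> 0" "\<And>y. y \<in> span B \<Longrightarrow> orthogonal x y"
    using orthogonal_to_subspace_exists by metis
  then have "\<exists>x. x \<noteq> 0 \<and> (\<forall>b\<in>B. b \<bullet> x = 0)"
    by (metis orthogonal_def orthogonal_commute span_base)
  from symmetric_eigenvector_orthogonal[OF sym _ this] B(3) obtain v l
    where v: "norm v = 1" "\<And>b. b \<in> B \<Longrightarrow> b \<bullet> v = 0" "A *v v = l *\<^sub>R v" by blast
  have "v \<notin> B" using v by (metis dot_square_norm one_neq_zero power_one)
  then show ?case
    using B v by (intro exI[of _ "insert v B"]) (auto simp: inner_commute)
qed

definition diag_matrix :: "real^'n \<Rightarrow> real^'n^'n" where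
  "diag_matrix d = (\<chi> i j. if i = j then d $ i else 0)"

lemma symmetric_diagonalize:
  fixes A :: "real^'n^'n"
  assumes sym: "transpose A = A"
  obtains Q d where "orthogonal_matrix Q" "A = Q ** diag_matrix d ** transpose Q"
proof -
  from symmetric_orthonormal_eigenvectors[OF sym, of "CARD('n)"] obtain B where B: "finite B" "card B = CARD('n)"
     "\<And>b. b \<in> B \<Longrightarrow> norm b = 1 \<and> (\<exists>l. A *v b = l *\<^sub>R b)"
     "\<And>b c. b \<in> B \<Longrightarrow> c \<in> B \<Longrightarrow> b \<noteq> c \<Longrightarrow> b \<bullet> c = 0" by force
  obtain f :: "'n \<Rightarrow> real^'n" where f: "bij_betw f UNIV B"
    using finite_same_card_bij[of "UNIV :: 'n set" B] B by auto
  have fB: "f j \<in> B" for j using f by (auto simp: bij_betw_def)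
  have finj: "f i = f j \<longleftrightarrow> i = j" for i j using f by (auto simp: bij_betw_def inj_on_def)
  define d where "d = (\<chi> j. SOME l. A *v f j = l *\<^sub>R f j)"
  have d: "A *v f j = d $ j *\<^sub>R f j" for j
    using someI_ex[of "\<lambda>l. A *v f j = l *\<^sub>R f j"] B(3)[OF fB] by (simp add: d_def)
  define Q :: "real^'n^'n" where "Q = (\<chi> i j. f j $ i)"
  have "transpose Q ** Q = mat 1"
  proof -
    have "(transpose Q ** Q) $ i $ j = f i \<bullet> f j" for i j
      by (simp add: matrix_matrix_mult_def transpose_def Q_def inner_vec_def)
    moreover have "f i \<bullet> f j = (if i = j then 1 else 0)" for i j
      using B(3)[OF fB, of i] B(4)[OF fB fB, of i j] finj by (auto simp: dot_square_norm)
    ultimately show ?thesis by (simp add: vec_eq_iff mat_def)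
  qed
  then have orth: "orthogonal_matrix Q" by (simp add: orthogonal_matrix)
  have "A ** Q = Q ** diag_matrix d"
  proof -
    have "(A ** Q) $ i $ j = (A *v f j) $ i" for i j
      by (simp add: matrix_matrix_mult_def matrix_vector_mult_def Q_def)
    moreover have "(Q ** diag_matrix d) $ i $ j = f j $ i * d $ j" for i j
      by (simp add: matrix_matrix_mult_def diag_matrix_def Q_def if_distrib cong: if_cong)
    ultimately show ?thesis by (simp add: vec_eq_iff d)
  qed
  then have "Q ** diag_matrix d ** transpose Q = A ** (Q ** transpose Q)"
    by (simp add: matrix_mul_assoc)
  also have "\<dots> = A" using orth by (simp add: orthogonal_matrix_def)
  finally show ?thesis using that orth by metis
qed

section \<open>Power sums of eigenvalues as traces of matrix powers\<close>

lemma mpow_0 [simp]: "mpow P 0 = mat 1" by (simp add: mpow_def)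

lemma mpow_Suc: "mpow P (Suc j) = P ** mpow P j" by (simp add: mpow_def)

lemma mpow_Suc2: "mpow P (Suc j) = mpow P j ** P"
  proof (induction j)
  case (Suc j)
  have "mpow P (Suc (Suc j)) = P ** mpow P (Suc j)" by (rule mpow_Suc)
  also have "\<dots> = P ** mpow P j ** P" by (simp only: Suc.IH matrix_mul_assoc)
  finally show ?case by (simp only: mpow_Suc)
qed (simp add: mpow_Suc)

lemma mpow_orthogonal_conj:
  assumes "orthogonal_matrix Q"
  shows "mpow (Q ** D ** transpose Q) j = Q ** mpow D j ** transpose Q"
proof (induction j)
  case 0
  then show ?case using assms by (simp add: orthogonal_matrix_def)
next
  case (Suc j)
  have "Q ** D ** transpose Q ** (Q ** mpow D j ** transpose Q)
    = Q ** D ** (transpose Q ** Q) ** mpow D j ** transpose Q"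
    by (simp only: matrix_mul_assoc)
  also have "\<dots> = Q ** (D ** mpow D j) ** transpose Q"
    using assms by (simp add: orthogonal_matrix matrix_mul_assoc)
  finally show ?case unfolding mpow_Suc Suc .
qed

lemma mpow_diag: "mpow (diag_matrix d) j = diag_matrix (\<chi> i. (d $ i) ^ j)"
proof (induction j)
  case 0
  then show ?case by (simp add: diag_matrix_def mat_def vec_eq_iff)
next
  case (Suc j)
  then show ?case
    by (simp add: mpow_Suc diag_matrix_def matrix_matrix_mult_def vec_eq_iff if_distrib if_distribR cong: if_cong)
qed

lemma trace_orthogonal_conj:
  fixes Q D :: "real^'n^'n"
  assumes "orthogonal_matrix Q"
  shows "trace (Q ** D ** transpose Q) = trace D"
proof -
  have "trace (Q ** D ** transpose Q) = trace (transpose Q ** (Q ** D))" by (rule trace_mul_sym)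
  also have "transpose Q ** (Q ** D) = D" using assms by (simp add: orthogonal_matrix matrix_mul_assoc)
  finally show ?thesis .
qed

lemma trace_mpow_conj_diag:
  assumes "orthogonal_matrix Q"
  shows "trace (mpow (Q ** diag_matrix d ** transpose Q) j) = (\<Sum>i\<in>UNIV. (d $ i) ^ j)"
  by (simp add: mpow_orthogonal_conj assms trace_orthogonal_conj mpow_diag)
     (simp add: trace_def diag_matrix_def)

lemma eigenvalues_conj_diag:
  fixes d :: "real^'n"
  assumes "orthogonal_matrix Q"
  shows "eigenvalues (Q ** diag_matrix d ** transpose Q) d"
  unfolding eigenvalues_def
proof
  fix t
  have "mat t - Q ** diag_matrix d ** transpose Q = Q ** mat t ** transpose Q - Q ** diag_matrix d ** transpose Q"
  proof -
    have "Q ** mat t = t *\<^sub>R Q"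
      by (simp add: matrix_matrix_mult_def mat_def vec_eq_iff if_distrib cong: if_cong)
    then have "Q ** mat t ** transpose Q = t *\<^sub>R (Q ** transpose Q)" by (simp add: matrix_matrix_mult_def vec_eq_iff sum_distrib_left mult.assoc)
    also have "\<dots> = mat t" using assms by (simp add: orthogonal_matrix_def mat_def vec_eq_iff)
    finally show ?thesis by simp
  qed
  also have "\<dots> = Q ** (mat t - diag_matrix d) ** transpose Q"
    by (simp add: matrix_matrix_mult_def vec_eq_iff sum_subtractf left_diff_distrib right_diff_distrib)
  finally have "det (mat t - Q ** diag_matrix d ** transpose Q) = det (mat t - diag_matrix d) * (det Q * det (transpose Q))"
    by (simp add: det_mul)
  also have "det Q * det (transpose Q) = det (Q ** transpose Q)" by (simp add: det_mul)
  also have "\<dots> = 1" using assms by (simp add: orthogonal_matrix_def)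
  also have "det (mat t - diag_matrix d) = (\<Prod>i\<in>UNIV. (mat t - diag_matrix d) $ i $ i)"
    by (rule det_diagonal) (simp add: mat_def diag_matrix_def)
  finally show "det (mat t - Q ** diag_matrix d ** transpose Q) = (\<Prod>j\<in>UNIV. t - d $ j)"
    by (simp add: mat_def diag_matrix_def)
qed

text \<open>The characteristic polynomial determines the multiset of its roots, hence every
  symmetric function of them. This makes the choice of \<mu> inside \<open>sigma_inf_mat\<close>
  harmless.\<close>

lemma power_sum_eq_if_eigenvalues:
  fixes \<mu> \<nu> :: "real^'n"
  assumes "eigenvalues P \<mu>" "eigenvalues P \<nu>"
  shows "(\<Sum>i\<in>UNIV. (\<mu> $ i) ^ j) = (\<Sum>i\<in>UNIV. (\<nu> $ i) ^ j)"
proof -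
  have roots: "proots (\<Prod>i\<in>UNIV. [:- \<mu> $ i, 1:]) = image_mset (($) \<mu>) (mset_set UNIV)" for \<mu> :: "real^'n"
    by (subst proots_prod) (auto simp: proots_linear_factor sum_unfold_sum_mset)
  have "poly (\<Prod>i\<in>UNIV. [:- \<mu> $ i, 1:]) t = poly (\<Prod>i\<in>UNIV. [:- \<nu> $ i, 1:]) t" for t
    using assms by (simp add: eigenvalues_def poly_prod)
  then have "(\<Prod>i\<in>UNIV. [:- \<mu> $ i, 1:]) = (\<Prod>i\<in>UNIV. [:- \<nu> $ i, 1:])"
    by (simp add: poly_eq_poly_eq_iff[symmetric] ext)
  then have eq: "image_mset (($) \<mu>) (mset_set UNIV) = image_mset (($) \<nu>) (mset_set UNIV)"
    using roots by metis
  have "(\<Sum>i\<in>UNIV. (\<mu> $ i) ^ j) = \<Sum>\<^sub># (image_mset (\<lambda>x. x ^ j) (image_mset (($) \<mu>) (mset_set UNIV)))" for \<mu> :: "real^'n"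
    by (simp add: sum_unfold_sum_mset image_mset.compositionality o_def)
  then show ?thesis using eq by metis
qed

section \<open>Newton tensors and their divergence\<close>

text \<open>Newton's recursion detached from the origin of the power sums: \<open>p\<close> may come
  from an eigenvalue list, from traces of matrix powers, or be a family of functions to be
  differentiated.\<close>

fun power_sum_seq :: "(nat \<Rightarrow> real) \<Rightarrow> nat \<Rightarrow> real" where
  "power_sum_seq p 0 = 1"
| "power_sum_seq p (Suc k) = (\<Sum>i\<le>k. p i * power_sum_seq p (k - i)) / real (Suc k)"

declare power_sum_seq.simps(2) [simp del]

lemma power_sum_seq_Suc: "real (Suc k) * power_sum_seq p (Suc k) = (\<Sum>i\<le>k. p i * power_sum_seq p (k - i))"
  by (simp add: power_sum_seq.simps(2) del: of_nat_Suc)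

definition signed_trace :: "real \<Rightarrow> real^'n^'n \<Rightarrow> nat \<Rightarrow> real" where
  "signed_trace m0 P i = (if i = 0 then m0 else 0) + (-1) ^ i * trace (mpow P (Suc i))"

definition sigma_tr :: "nat \<Rightarrow> real \<Rightarrow> real^'n^'n \<Rightarrow> real" where
  "sigma_tr k m0 P = power_sum_seq (signed_trace m0 P) k"

lemma sigma_inf_eq_power_sum_seq:
  "sigma_inf k m0 \<mu> = power_sum_seq (\<lambda>i. (if i = 0 then m0 else 0) + (-1) ^ i * (\<Sum>j\<in>UNIV. (\<mu> $ j) ^ Suc i)) k"
    (is "_ = power_sum_seq ?p k")
proof (induction k rule: less_induct)
  case (less k)
  show ?case
  proof (cases k)
    case (Suc n)
    have IH: "sigma_inf m m0 \<mu> = power_sum_seq ?p m" if "m \<le> n" for m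
      using less.IH[of m] that Suc by simp
    have "(\<Sum>i\<le>n. ?p i * power_sum_seq ?p (n - i)) = (\<Sum>i=0..n. ?p i * sigma_inf (n - i) m0 \<mu>)"
      by (intro sum.cong) (auto simp: IH)
    also have "\<dots> = ?p 0 * sigma_inf n m0 \<mu> + (\<Sum>i=1..n. ?p i * sigma_inf (n - i) m0 \<mu>)"
      by (subst sum.atLeast_Suc_atMost) auto
    also have "(\<Sum>i=1..n. ?p i * sigma_inf (n - i) m0 \<mu>)
      = (\<Sum>i=1..n. \<Sum>j\<in>UNIV. (-1) ^ i * sigma_inf (n - i) m0 \<mu> * (\<mu> $ j) ^ (i + 1))"
      by (intro sum.cong refl) (simp add: sum_distrib_right sum_distrib_left mult_ac)
    also have "?p 0 * sigma_inf n m0 \<mu> = sigma_inf n m0 \<mu> * (m0 + (\<Sum>j\<in>UNIV. \<mu> $ j))" by simp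
    finally show ?thesis unfolding Suc power_sum_seq.simps sigma_inf.simps by simp
  qed simp
qed

lemma sigma_tr_conj_diag:
  assumes "orthogonal_matrix Q"
  shows "sigma_tr k m0 (Q ** diag_matrix d ** transpose Q) = sigma_inf k m0 d"
  by (simp add: sigma_inf_eq_power_sum_seq sigma_tr_def signed_trace_def[abs_def]
      trace_mpow_conj_diag assms del: power_Suc)

lemma sigma_inf_mat_eq_sigma_tr:
  assumes "transpose P = P"
  shows "sigma_inf_mat k m0 P = sigma_tr k m0 P"
proof -
  from symmetric_diagonalize[OF assms] obtain Q d
    where Q: "orthogonal_matrix Q" and P: "P = Q ** diag_matrix d ** transpose Q" .
  have d: "eigenvalues P d" using eigenvalues_conj_diag[OF Q] P by simp
  then have "eigenvalues P (SOME \<mu>. eigenvalues P \<mu>)" by (rule someI)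
  from power_sum_eq_if_eigenvalues[OF this d]
  show ?thesis
    unfolding sigma_inf_mat_def sigma_tr_conj_diag[OF Q, of k m0 d, folded P] sigma_inf_eq_power_sum_seq
    by presburger
qed

definition newton_tensor :: "nat \<Rightarrow> real \<Rightarrow> real^'n^'n \<Rightarrow> real^'n^'n" where
  "newton_tensor k m0 P = (\<Sum>l\<le>k. ((-1) ^ l * sigma_tr (k - l) m0 P) *\<^sub>R mpow P l)"

lemma sigma_tr_0 [simp]: "sigma_tr 0 m0 P = 1" by (simp add: sigma_tr_def)

lemma newton_tensor_0 [simp]: "newton_tensor 0 m0 P = mat 1" by (simp add: newton_tensor_def)

lemma bounded_bilinear_matrix_mult:
  "bounded_bilinear ((**) :: real^'n^'n \<Rightarrow> real^'n^'n \<Rightarrow> real^'n^'n)"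
  unfolding bilinear_conv_bounded_bilinear[symmetric] bilinear_def
  by (auto intro!: linearI simp: matrix_matrix_mult_def vec_eq_iff sum.distrib sum_distrib_left algebra_simps)

interpretation mat_bb: bounded_bilinear "(**) :: real^'n^'n \<Rightarrow> real^'n^'n \<Rightarrow> real^'n^'n"
  by (rule bounded_bilinear_matrix_mult)

lemma bounded_linear_trace: "bounded_linear (trace :: real^'n^'n \<Rightarrow> real)"
  unfolding linear_conv_bounded_linear[symmetric]
  by (auto intro!: linearI simp: trace_def sum.distrib sum_distrib_left)

lemmas trace_sum = linear_sum[OF bounded_linear.linear[OF bounded_linear_trace]]
  and trace_scaleR = linear_scale[OF bounded_linear.linear[OF bounded_linear_trace]]
  and trace_has_derivative = bounded_linear.has_derivative[OF bounded_linear_trace]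

lemma newton_tensor_Suc:
  "newton_tensor (Suc k) m0 P = sigma_tr (Suc k) m0 P *\<^sub>R mat 1 - P ** newton_tensor k m0 P"
  by (simp add: newton_tensor_def sum.atMost_Suc_shift mat_bb.sum_right mat_bb.scaleR_right mpow_Suc sum_negf
      del: sum.atMost_Suc)

lemma newton_tensor_commute: "P ** newton_tensor k m0 P = newton_tensor k m0 P ** P"
  by (simp add: newton_tensor_def mat_bb.sum_right mat_bb.scaleR_right mat_bb.sum_left mat_bb.scaleR_left
      flip: mpow_Suc mpow_Suc2)

lemma sum_eq_newton_tensor:
  "(\<Sum>j=1..Suc k. ((-1) ^ j * sigma_tr (Suc k - j) m0 P) *\<^sub>R mpow P j) = - (P ** newton_tensor k m0 P)"
proof -
  have "(\<Sum>j=1..Suc k. ((-1) ^ j * sigma_tr (Suc k - j) m0 P) *\<^sub>R mpow P j)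
     = (\<Sum>j=0..k. ((-1) ^ Suc j * sigma_tr (Suc k - Suc j) m0 P) *\<^sub>R mpow P (Suc j))"
    unfolding One_nat_def by (rule sum.shift_bounds_cl_Suc_ivl)
  also have "\<dots> = - (P ** newton_tensor k m0 P)"
    by (simp add: newton_tensor_def mat_bb.sum_right mat_bb.scaleR_right mpow_Suc sum_negf atMost_atLeast0)
  finally show ?thesis .
qed

lemma trace_newton_tensor_mult:
  "trace (newton_tensor k m0 P ** M) = (\<Sum>l\<le>k. (-1) ^ l * sigma_tr (k - l) m0 P * trace (mpow P l ** M))"
  by (simp add: newton_tensor_def mat_bb.sum_left mat_bb.scaleR_left trace_sum trace_scaleR)

text \<open>The power sums \<open>p\<^sub>i\<close> are the coefficients of the logarithmic derivative of the generating
  function of \<open>power_sum_seq p\<close>; this is the recursion differentiated.\<close>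
lemma power_sum_seq_has_derivative:
  fixes p :: "nat \<Rightarrow> 'a::real_normed_vector \<Rightarrow> real"
  assumes p: "\<And>i. (p i has_derivative (\<lambda>h. real (Suc i) * q i h)) (at x)"
  shows "((\<lambda>x. power_sum_seq (\<lambda>i. p i x) k) has_derivative
     (\<lambda>h. \<Sum>l<k. q l h * power_sum_seq (\<lambda>i. p i x) (k - Suc l))) (at x)"
proof (induction k rule: less_induct)
  case (less k)
  show ?case
  proof (cases k)
    case 0
    then show ?thesis by simp
  next
    case (Suc n)
    let ?s = "power_sum_seq (\<lambda>i. p i x)"
    let ?D = "\<lambda>k h. \<Sum>l<k. q l h * ?s (k - Suc l)"
    have IH: "((\<lambda>x. power_sum_seq (\<lambda>i. p i x) (n - i)) has_derivative ?D (n - i)) (at x)" for i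
      using less.IH[of "n - i"] Suc by simp
    have d: "((\<lambda>x. power_sum_seq (\<lambda>i. p i x) (Suc n)) has_derivative
       (\<lambda>h. (\<Sum>i\<le>n. p i x * ?D (n - i) h + real (Suc i) * q i h * ?s (n - i)) * (1 / real (Suc n)))) (at x)"
      unfolding power_sum_seq.simps(2) divide_inverse
      by (auto intro!: derivative_eq_intros IH p simp: inverse_eq_divide simp del: of_nat_Suc)
    have "(\<Sum>i\<le>n. p i x * ?D (n - i) h + real (Suc i) * q i h * ?s (n - i)) * (1 / real (Suc n)) = ?D (Suc n) h" for h
    proof -
      have "(\<Sum>i\<le>n. p i x * ?D (n - i) h) = (\<Sum>i\<le>n. \<Sum>l<n - i. p i x * (q l h * ?s (n - i - Suc l)))"
        by (simp add: sum_distrib_left)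
      \<comment> \<open>Exchanging the triangular sums makes the inner sum over i the recursion
        itself at index n - l.\<close>
      also have "\<dots> = (\<Sum>l<n. \<Sum>i<n - l. p i x * (q l h * ?s (n - i - Suc l)))"
      proof -
        have "(\<Sum>i\<le>n. \<Sum>l<n - i. p i x * (q l h * ?s (n - i - Suc l)))
          = (\<Sum>(i,l)\<in>(SIGMA i:{..n}. {..<n - i}). p i x * (q l h * ?s (n - i - Suc l)))"
          by (subst sum.Sigma) auto
        also have "\<dots> = (\<Sum>(l,i)\<in>(SIGMA l:{..<n}. {..<n - l}). p i x * (q l h * ?s (n - i - Suc l)))"
          by (rule sum.reindex_bij_witness[of _ "\<lambda>(l,i). (i,l)" "\<lambda>(i,l). (l,i)"]) auto
        also have "\<dots> = (\<Sum>l<n. \<Sum>i<n - l. p i x * (q l h * ?s (n - i - Suc l)))"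
          by (subst sum.Sigma) auto
        finally show ?thesis .
      qed
      also have "\<dots> = (\<Sum>l<n. q l h * (real (n - l) * ?s (n - l)))"
      proof (intro sum.cong refl)
        fix l assume "l \<in> {..<n}"
        then obtain m where m: "n = Suc (l + m)" using less_imp_Suc_add by blast
        have "(\<Sum>i<n - l. p i x * (q l h * ?s (n - i - Suc l))) = q l h * (\<Sum>i\<le>m. p i x * ?s (m - i))"
          by (simp add: m sum_distrib_left lessThan_Suc_atMost mult_ac diff_diff_left
              add.commute[of l] cong: sum.cong)
        also have "(\<Sum>i\<le>m. p i x * ?s (m - i)) = real (n - l) * ?s (n - l)"
          unfolding m by (simp flip: power_sum_seq_Suc)
        finally show "(\<Sum>i<n - l. p i x * (q l h * ?s (n - i - Suc l))) = q l h * (real (n - l) * ?s (n - l))" .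
      qed
      \<comment> \<open>The added term l = n carries the factor n - l = 0. With equal ranges the
        weights n - l and l + 1 add up to n + 1, which cancels the denominator.\<close>
      also have "\<dots> = (\<Sum>l\<le>n. q l h * (real (n - l) * ?s (n - l)))"
        by (simp add: lessThan_Suc_atMost[symmetric])
      finally have "(\<Sum>i\<le>n. p i x * ?D (n - i) h + real (Suc i) * q i h * ?s (n - i))
         = (\<Sum>l\<le>n. q l h * (real (n - l) * ?s (n - l)) + real (Suc l) * q l h * ?s (n - l))"
        by (simp add: sum.distrib)
      also have "\<dots> = (\<Sum>l\<le>n. real (Suc n) * (q l h * ?s (n - l)))"
        by (intro sum.cong refl) (simp add: of_nat_diff algebra_simps)
      also have "\<dots> = real (Suc n) * ?D (Suc n) h"
        by (simp add: sum_distrib_left lessThan_Suc_atMost del: of_nat_Suc)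
      finally show ?thesis by (simp del: of_nat_Suc)
    qed
    with d show ?thesis unfolding Suc by simp
  qed
qed

lemma trace_mult_commute: "trace (A ** B) = trace (B ** A)" for A B :: "real^'n^'n"
  by (rule trace_mul_sym)

lemma mpow_add: "mpow P (i + j) = mpow P i ** mpow P j"
  by (induction i) (simp_all add: mpow_Suc matrix_mul_assoc)

lemma sum_mult_mat_1: "(\<Sum>i\<in>UNIV. f i * (mat 1 :: real^'n^'n) $ i $ j) = f j"
  by (simp add: mat_def if_distrib cong: if_cong)

section \<open>Derivatives of matrix powers, of sigma and of the Newton tensors\<close>

locale matrix_deriv =
  fixes P :: "real^'n \<Rightarrow> real^'n^'n" and m0 :: "real^'n \<Rightarrow> real"
    and x :: "real^'n" and P' :: "real^'n \<Rightarrow> real^'n^'n" and m0' :: "real^'n \<Rightarrow> real"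
  assumes P': "(P has_derivative P') (at x)" and m0': "(m0 has_derivative m0') (at x)"
begin

primrec mpow' :: "nat \<Rightarrow> real^'n \<Rightarrow> real^'n^'n" where
  "mpow' 0 h = 0"
| "mpow' (Suc j) h = P x ** mpow' j h + P' h ** mpow (P x) j"

lemma mpow_has_derivative: "((\<lambda>x. mpow (P x) j) has_derivative mpow' j) (at x)"
proof (induction j)
  case 0
  then show ?case by simp
next
  case (Suc j)
  from mat_bb.FDERIV[OF P' Suc] show ?case by (simp add: mpow_Suc)
qed

text \<open>P' need not commute with P, but cyclicity of the trace moves each of the
  \<open>Suc j\<close> occurrences of P' to the end, where all contributions agree. The left factor
  \<open>mpow (P x) m\<close> is the generalization that carries the induction.\<close>

lemma trace_mpow': "trace (mpow (P x) m ** mpow' (Suc j) h) = real (Suc j) * trace (mpow (P x) (m + j) ** P' h)"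
proof (induction j arbitrary: m)
  case 0
  then show ?case by simp
next
  case (Suc j)
  have "trace (mpow (P x) m ** mpow' (Suc (Suc j)) h)
     = trace (mpow (P x) (Suc m) ** mpow' (Suc j) h) + trace (mpow (P x) m ** (P' h ** mpow (P x) (Suc j)))"
    by (simp only: mpow'.simps(2)[of "Suc j"] mat_bb.add_right trace_add mpow_Suc2 matrix_mul_assoc)
  also have "trace (mpow (P x) m ** (P' h ** mpow (P x) (Suc j))) = trace (mpow (P x) (Suc j) ** mpow (P x) m ** P' h)"
    by (metis matrix_mul_assoc trace_mult_commute)
  also have "mpow (P x) (Suc j) ** mpow (P x) m = mpow (P x) (m + Suc j)"
    by (simp add: add.commute flip: mpow_add)
  finally show ?case unfolding Suc.IH by (simp add: algebra_simps)
qed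

lemma sigma_tr_has_derivative:
  "((\<lambda>x. sigma_tr (Suc k) (m0 x) (P x)) has_derivative
    (\<lambda>h. sigma_tr k (m0 x) (P x) * m0' h + trace (newton_tensor k (m0 x) (P x) ** P' h))) (at x)"
proof -
  \<comment> \<open>The derivative of the trace of the power \<open>Suc i\<close> has the factor
    \<open>Suc i\<close>, as \<open>power_sum_seq_has_derivative\<close> expects; \<open>m0\<close>
    occurs only at i = 0, where this factor is 1.\<close>
  define q where "q = (\<lambda>i h. (if i = 0 then m0' h else 0) + (-1) ^ i * trace (mpow (P x) i ** P' h))"
  have "((\<lambda>x. signed_trace (m0 x) (P x) i) has_derivative (\<lambda>h. real (Suc i) * q i h)) (at x)" for i
  proof -
    have "((\<lambda>x. trace (mpow (P x) (Suc i))) has_derivative (\<lambda>h. trace (mpow' (Suc i) h))) (at x)"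
      by (rule trace_has_derivative) (rule mpow_has_derivative)
    moreover have "trace (mpow' (Suc i) h) = real (Suc i) * trace (mpow (P x) i ** P' h)" for h
      using trace_mpow'[of 0 i h] by simp
    moreover have "((\<lambda>x. if i = 0 then m0 x else 0) has_derivative (\<lambda>h. real (Suc i) * (if i = 0 then m0' h else 0))) (at x)"
      using m0' by (cases "i = 0") auto
    ultimately show ?thesis
      unfolding signed_trace_def q_def
      by (auto intro!: derivative_eq_intros simp: algebra_simps)
  qed
  note D = power_sum_seq_has_derivative[OF this, of "Suc k"]
  have "(\<Sum>l<Suc k. q l h * sigma_tr (Suc k - Suc l) (m0 x) (P x))
     = sigma_tr k (m0 x) (P x) * m0' h + trace (newton_tensor k (m0 x) (P x) ** P' h)" for h
  proof -
    have "(\<Sum>l<Suc k. q l h * sigma_tr (Suc k - Suc l) (m0 x) (P x))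
      = (\<Sum>l\<le>k. (if l = 0 then m0' h * sigma_tr (k - l) (m0 x) (P x) else 0)) +
        (\<Sum>l\<le>k. (-1) ^ l * sigma_tr (k - l) (m0 x) (P x) * trace (mpow (P x) l ** P' h))"
      unfolding q_def lessThan_Suc_atMost sum.distrib[symmetric]
      by (intro sum.cong) (auto simp: algebra_simps)
    then show ?thesis unfolding trace_newton_tensor_mult by simp
  qed
  with D show ?thesis unfolding sigma_tr_def by simp
qed

text \<open>This differentiates T(k+1) = \<sigma>(k+1) I - T(k) P with P on the right. That order
  matters for the divergence: the row index is summed against the derivative of T(k) alone, so the
  divergence of T(k) appears as a factor and an induction on k closes.\<close>

primrec newton' :: "nat \<Rightarrow> real^'n \<Rightarrow> real^'n^'n" where
  "newton' 0 h = 0"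
| "newton' (Suc k) h = (sigma_tr k (m0 x) (P x) * m0' h + trace (newton_tensor k (m0 x) (P x) ** P' h)) *\<^sub>R mat 1
     - (newton_tensor k (m0 x) (P x) ** P' h + newton' k h ** P x)"

lemma newton_tensor_has_derivative:
  "((\<lambda>x. newton_tensor k (m0 x) (P x)) has_derivative newton' k) (at x)"
proof (induction k)
  case 0
  then show ?case by simp
next
  case (Suc k)
  have "((\<lambda>x. sigma_tr (Suc k) (m0 x) (P x) *\<^sub>R mat 1 - newton_tensor k (m0 x) (P x) ** P x) has_derivative newton' (Suc k)) (at x)"
    using has_derivative_diff[OF has_derivative_scaleR_left[OF sigma_tr_has_derivative[of k], of "mat 1"] mat_bb.FDERIV[OF Suc P']]
    by (rule has_derivative_eq_rhs) (simp add: fun_eq_iff)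
  then show ?case unfolding newton_tensor_Suc newton_tensor_commute .
qed

text \<open>For a Codazzi tensor the derivative of \<open>\<sigma>\<^sub>k\<close> cancels the terms with \<open>P'\<close>.\<close>
lemma div_newton_tensor:
  assumes codazzi: "\<And>i j l. P' (axis i 1) $ l $ j = P' (axis j 1) $ l $ i"
  shows "(\<Sum>i\<in>UNIV. newton' (Suc k) (axis i 1) $ i $ j)
     = (\<Sum>i\<in>UNIV. m0' (axis i 1) * newton_tensor k (m0 x) (P x) $ i $ j)"
proof (induction k arbitrary: j)
  case 0
  have "(\<Sum>i\<in>UNIV. newton' (Suc 0) (axis i 1) $ i $ j)
     = m0' (axis j 1) + trace (P' (axis j 1)) - (\<Sum>i\<in>UNIV. P' (axis i 1) $ i $ j)"
    by (simp add: sum_subtractf sum_mult_mat_1)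
  also have "(\<Sum>i\<in>UNIV. P' (axis i 1) $ i $ j) = trace (P' (axis j 1))"
    unfolding trace_def by (intro sum.cong refl codazzi)
  finally show ?case by (simp add: sum_mult_mat_1)
next
  case (Suc k)
  let ?T = "newton_tensor (Suc k) (m0 x) (P x)" and ?U = "newton_tensor k (m0 x) (P x)"
  let ?s = "sigma_tr (Suc k) (m0 x) (P x)"
  have "(\<Sum>i\<in>UNIV. newton' (Suc (Suc k)) (axis i 1) $ i $ j)
     = (?s * m0' (axis j 1) + trace (?T ** P' (axis j 1)))
       - ((\<Sum>i\<in>UNIV. (?T ** P' (axis i 1)) $ i $ j) + (\<Sum>i\<in>UNIV. (newton' (Suc k) (axis i 1) ** P x) $ i $ j))"
    unfolding newton'.simps(2)[where k = "Suc k"]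
    by (simp add: sum_subtractf sum.distrib sum_mult_mat_1 del: newton'.simps)
  also have "(\<Sum>i\<in>UNIV. (?T ** P' (axis i 1)) $ i $ j) = trace (?T ** P' (axis j 1))"
    unfolding trace_def matrix_matrix_mult_def by (simp add: codazzi[of _ _ j])
  also have "(\<Sum>i\<in>UNIV. (newton' (Suc k) (axis i 1) ** P x) $ i $ j)
     = (\<Sum>l\<in>UNIV. (\<Sum>i\<in>UNIV. newton' (Suc k) (axis i 1) $ i $ l) * P x $ l $ j)"
    unfolding matrix_matrix_mult_def by (simp add: sum_distrib_right del: newton'.simps) (rule sum.swap)
  also have "\<dots> = (\<Sum>i\<in>UNIV. m0' (axis i 1) * (?U ** P x) $ i $ j)"
    unfolding Suc.IH matrix_matrix_mult_def
    by (simp add: sum_distrib_right sum_distrib_left mult.assoc) (rule sum.swap)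
  finally show ?case
    unfolding newton_tensor_Suc newton_tensor_commute
    by (simp add: right_diff_distrib sum_subtractf mult.assoc[symmetric] sum_mult_mat_1)
qed

end

text \<open>In an eigenbasis of P the trace is the sum of d_i^2 c_i, where c_i are the eigenvalues
  of the Newton tensor. By \<open>sigma_inf_drop_pos\<close> each (-1)^k c_i is strictly positive,
  so vanishing of the sum forces every d_i to vanish.\<close>

lemma newton_tensor_trace_sign:
  fixes P :: "real^'n^'n"
  assumes sym: "transpose P = P"
    and pos: "\<And>j. j \<in> {1..Suc k} \<Longrightarrow> (-1) ^ j * sigma_tr j m0 P > 0"
  shows "(-1) ^ k * trace (newton_tensor k m0 P ** (P ** P)) \<ge> 0"
    and "trace (newton_tensor k m0 P ** (P ** P)) = 0 \<Longrightarrow> P = 0"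
proof -
  from symmetric_diagonalize[OF sym] obtain Q d
    where Q: "orthogonal_matrix Q" and P: "P = Q ** diag_matrix d ** transpose Q" .
  have s: "sigma_tr j m0 P = sigma_inf j m0 d" for j unfolding P by (rule sigma_tr_conj_diag[OF Q])
  define c where "c = (\<lambda>i. \<Sum>l\<le>k. (-1) ^ l * sigma_inf (k - l) m0 d * (d $ i) ^ l)"
  have c: "(-1) ^ k * c i > 0" for i
    unfolding c_def using pos s by (intro sigma_inf_drop_pos) auto
  have "mpow P l ** (P ** P) = mpow P (l + 2)" for l
    by (simp add: mpow_Suc2 matrix_mul_assoc)
  then have "trace (newton_tensor k m0 P ** (P ** P))
      = (\<Sum>l\<le>k. (-1) ^ l * sigma_inf (k - l) m0 d * (\<Sum>i\<in>UNIV. (d $ i) ^ (l + 2)))"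
    unfolding trace_newton_tensor_mult s by (simp only: P trace_mpow_conj_diag[OF Q])
  also have "\<dots> = (\<Sum>l\<le>k. \<Sum>i\<in>UNIV. (d $ i)\<^sup>2 * ((-1) ^ l * sigma_inf (k - l) m0 d * (d $ i) ^ l))"
    by (simp add: sum_distrib_left power_add power2_eq_square mult_ac)
  also have "\<dots> = (\<Sum>i\<in>UNIV. (d $ i)\<^sup>2 * c i)"
    unfolding c_def sum_distrib_left by (rule sum.swap)
  finally have eq: "(-1) ^ k * trace (newton_tensor k m0 P ** (P ** P)) = (\<Sum>i\<in>UNIV. (d $ i)\<^sup>2 * ((-1) ^ k * c i))"
    by (simp add: sum_distrib_left mult_ac)
  have nn: "(d $ i)\<^sup>2 * ((-1) ^ k * c i) \<ge> 0" for i
    by (rule mult_nonneg_nonneg[OF zero_le_power2 less_imp_le[OF c]])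
  show "(-1) ^ k * trace (newton_tensor k m0 P ** (P ** P)) \<ge> 0"
    unfolding eq by (intro sum_nonneg nn)
  assume "trace (newton_tensor k m0 P ** (P ** P)) = 0"
  then have "(\<Sum>i\<in>UNIV. (d $ i)\<^sup>2 * ((-1) ^ k * c i)) = 0" using eq by simp
  then have "(d $ i)\<^sup>2 * ((-1) ^ k * c i) = 0" for i
    using sum_nonneg_eq_0_iff[of UNIV "\<lambda>i. (d $ i)\<^sup>2 * ((-1) ^ k * c i)"] nn by simp
  then have "d $ i = 0" for i using c[of i] by (metis less_irrefl mult_eq_0_iff power_eq_0_iff)
  then have "diag_matrix d = 0" by (simp add: diag_matrix_def vec_eq_iff)
  then show "P = 0" unfolding P by simp
qed

section \<open>Partial derivatives and integration by parts\<close>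

abbreviation partial :: "'n \<Rightarrow> (real^'n \<Rightarrow> real) \<Rightarrow> real^'n \<Rightarrow> real" where
  "partial i f x \<equiv> frechet_derivative f (at x) (axis i 1)"

lemma partial_eqI: "(f has_derivative f') (at x) \<Longrightarrow> partial i f x = f' (axis i 1)"
  using frechet_derivative_at by metis

lemma linear_eq_sum_axis:
  fixes f :: "real^'n \<Rightarrow> real"
  assumes "linear f"
  shows "f h = (\<Sum>i\<in>UNIV. h $ i * f (axis i 1))"
proof -
  have "f h = f (\<Sum>i\<in>UNIV. h $ i *\<^sub>R axis i 1)" by (simp add: basis_expansion flip: scalar_mult_eq_scaleR)
  also have "\<dots> = (\<Sum>i\<in>UNIV. h $ i * f (axis i 1))"
    using assms by (simp add: linear_sum linear_scale)
  finally show ?thesis .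
qed

lemma has_derivative_sum_partial:
  fixes f :: "real^'n \<Rightarrow> real"
  assumes "f differentiable (at x)"
  shows "(f has_derivative (\<lambda>h. \<Sum>i\<in>UNIV. h $ i * partial i f x)) (at x)"
proof -
  have d: "(f has_derivative frechet_derivative f (at x)) (at x)"
    using assms frechet_derivative_works by blast
  show ?thesis
    by (rule has_derivative_eq_rhs[OF d])
       (auto simp: fun_eq_iff intro: linear_eq_sum_axis has_derivative_linear[OF d])
qed

lemma Ck_Suc_iff:
  "Ck (Suc k) f \<longleftrightarrow> (\<forall>x. f differentiable (at x)) \<and> (\<forall>i. Ck k (partial i f))"
  by (simp add: differentiable_on_def)

declare Ck.simps [simp del]

lemma Ck_SucD: "Ck (Suc k) f \<Longrightarrow> Ck k f"
proof (induction k arbitrary: f)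
  case 0
  then show ?case by (simp add: Ck.simps differentiable_imp_continuous_on)
next
  case (Suc k)
  then show ?case using Ck_Suc_iff by blast
qed

lemma Ck_1_iff: "Ck 1 f \<longleftrightarrow> (\<forall>x. f differentiable (at x)) \<and> (\<forall>i. continuous_on UNIV (partial i f))"
  unfolding One_nat_def Ck_Suc_iff by (simp add: Ck.simps(1))

lemma Ck_1I:
  assumes "\<And>x. (f has_derivative f' x) (at x)" "\<And>i. continuous_on UNIV (\<lambda>x. f' x (axis i 1))"
  shows "Ck 1 f"
  using assms partial_eqI[OF assms(1)] unfolding Ck_1_iff differentiable_def by auto

lemma Ck_1_continuous: "Ck 1 f \<Longrightarrow> continuous_on S f"
  using Ck_SucD[of 0 f] by (auto simp: Ck.simps(1) intro: continuous_on_subset)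

lemma Ck_1_has_derivative: "Ck 1 f \<Longrightarrow> (f has_derivative frechet_derivative f (at x)) (at x)"
  using Ck_1_iff frechet_derivative_works by blast

lemma Ck_1_partial_continuous: "Ck 1 f \<Longrightarrow> continuous_on S (partial i f)"
  using Ck_1_iff by (auto intro: continuous_on_subset)

lemma Ck_1_const: "Ck 1 (\<lambda>x. c)"
  by (rule Ck_1I[where f' = "\<lambda>x h. 0"]) auto

lemma Ck_1_add:
  assumes "Ck 1 f" "Ck 1 g"
  shows "Ck 1 (\<lambda>x. f x + g x)"
  by (rule Ck_1I[OF has_derivative_add[OF assms[THEN Ck_1_has_derivative]]])
     (auto intro!: continuous_intros assms[THEN Ck_1_partial_continuous])

lemma Ck_1_mult:
  assumes "Ck 1 f" "Ck 1 g"
  shows "Ck 1 (\<lambda>x. f x * g x)"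
  by (rule Ck_1I[OF has_derivative_mult[OF assms[THEN Ck_1_has_derivative]]])
     (auto intro!: continuous_intros assms[THEN Ck_1_partial_continuous] assms[THEN Ck_1_continuous])

lemma Ck_1_compose_real:
  assumes f: "Ck 1 f" and g: "\<And>t. (g has_real_derivative g' t) (at t)" and g': "continuous_on UNIV g'"
  shows "Ck 1 (\<lambda>x. g (f x))"
proof (rule Ck_1I)
  fix x
  show "((\<lambda>x. g (f x)) has_derivative (\<lambda>h. g' (f x) * frechet_derivative f (at x) h)) (at x)"
    using has_derivative_compose[OF Ck_1_has_derivative[OF f] g[unfolded has_field_derivative_def]] .
next
  fix i
  show "continuous_on UNIV (\<lambda>x. g' (f x) * partial i f x)"
    by (intro continuous_intros continuous_on_compose2[OF g'] Ck_1_continuous f Ck_1_partial_continuous) auto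
qed

lemma smooth_Ck: "smooth f \<Longrightarrow> Ck k f"
  by (simp add: smooth_def)

lemma smooth_partial: "smooth f \<Longrightarrow> smooth (partial i f)"
  unfolding smooth_def by (metis Ck.simps(2))

lemma has_real_derivative_along_axis:
  assumes "f differentiable (at (x + s *\<^sub>R axis i 1))"
  shows "((\<lambda>s. f (x + s *\<^sub>R axis i 1)) has_real_derivative partial i f (x + s *\<^sub>R axis i 1)) (at s)"
proof -
  let ?p = "x + s *\<^sub>R axis i 1"
  have d: "(f has_derivative frechet_derivative f (at ?p)) (at ?p)"
    using assms frechet_derivative_works by blast
  have l: "((\<lambda>s. x + s *\<^sub>R axis i 1) has_derivative (\<lambda>t. t *\<^sub>R axis i 1)) (at s)"
    by (auto intro!: derivative_eq_intros)
  have "frechet_derivative f (at ?p) (t *\<^sub>R axis i 1) = t * partial i f ?p" for t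
    using linear_scale[OF has_derivative_linear[OF d]] by simp
  with has_derivative_compose[OF l d] show ?thesis
    by (simp add: has_field_derivative_def mult.commute[of "partial i f ?p"] mult_commute_abs)
qed

text \<open>The mean value theorem in direction i, applied to the difference in direction j, and
  then again in direction j. The left side is symmetric in i and j while the right side is one of
  the two mixed derivatives; \<open>partial_commute\<close> compares them as h tends to 0.\<close>

lemma second_difference_eq:
  fixes f :: "real^'n \<Rightarrow> real"
  assumes f: "\<And>x. f differentiable (at x)" and f': "\<And>x. partial i f differentiable (at x)" and h: "h > 0"
  shows "\<exists>s t. 0 < s \<and> s < h \<and> 0 < t \<and> t < h \<and>
    f (x + h *\<^sub>R axis i 1 + h *\<^sub>R axis j 1) - f (x + h *\<^sub>R axis i 1) - f (x + h *\<^sub>R axis j 1) + f x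
    = h * h * partial j (partial i f) (x + s *\<^sub>R axis i 1 + t *\<^sub>R axis j 1)"
proof -
  define y where "y = x + h *\<^sub>R axis j 1"
  define g where "g = (\<lambda>s. f (y + s *\<^sub>R axis i 1) - f (x + s *\<^sub>R axis i 1))"
  have "\<exists>s. 0 < s \<and> s < h \<and> g h - g 0 = (h - 0) * (partial i f (y + s *\<^sub>R axis i 1) - partial i f (x + s *\<^sub>R axis i 1))"
    unfolding g_def
    by (intro MVT2 h DERIV_diff has_real_derivative_along_axis f)
  then obtain s where s: "0 < s" "s < h"
    "g h - g 0 = h * (partial i f (y + s *\<^sub>R axis i 1) - partial i f (x + s *\<^sub>R axis i 1))" by auto
  define z where "z = x + s *\<^sub>R axis i 1"
  have "\<exists>t. 0 < t \<and> t < h \<and> partial i f (z + h *\<^sub>R axis j 1) - partial i f (z + 0 *\<^sub>R axis j 1)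
     = (h - 0) * partial j (partial i f) (z + t *\<^sub>R axis j 1)"
    by (intro MVT2 h has_real_derivative_along_axis f')
  then obtain t where t: "0 < t" "t < h" "partial i f (z + h *\<^sub>R axis j 1) - partial i f z
     = h * partial j (partial i f) (z + t *\<^sub>R axis j 1)" by auto
  have "z + h *\<^sub>R axis j 1 = y + s *\<^sub>R axis i 1" by (simp add: z_def y_def)
  then have "g h - g 0 = h * h * partial j (partial i f) (z + t *\<^sub>R axis j 1)"
    using s(3) t(3) by (simp flip: z_def)
  moreover have "g h - g 0 = f (x + h *\<^sub>R axis i 1 + h *\<^sub>R axis j 1) - f (x + h *\<^sub>R axis i 1) - f (x + h *\<^sub>R axis j 1) + f x"
    by (simp add: g_def y_def add_ac)
  ultimately show ?thesis using s t by (auto simp: z_def)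
qed

lemma partial_commute:
  assumes "Ck 2 f"
  shows "partial i (partial j f) x = partial j (partial i f) x"
proof -
  have f: "\<And>x. f differentiable (at x)" "\<And>i. Ck 1 (partial i f)"
    using assms Ck_Suc_iff[of 1 f] by (simp_all add: numeral_2_eq_2)
  then have f': "\<And>i x. partial i f differentiable (at x)" using Ck_1_iff by blast
  have lim: "(\<lambda>n. partial i (partial j f) (p n)) \<longlonglongrightarrow> partial i (partial j f) x" if "p \<longlonglongrightarrow> x" for p i j
    using Ck_1_partial_continuous[OF f(2), where S = UNIV] that
    by (auto simp: continuous_on_eq_continuous_within continuous_within_sequentially o_def)
  define h where "h = (\<lambda>n. 1 / real (Suc n))"
  have h: "h n > 0" for n by (simp add: h_def)
  have h0: "h \<longlonglongrightarrow> 0" unfolding h_def by (rule LIMSEQ_Suc[OF lim_1_over_n])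
  define \<Delta> where "\<Delta> = (\<lambda>i j n. f (x + h n *\<^sub>R axis i 1 + h n *\<^sub>R axis j 1) - f (x + h n *\<^sub>R axis i 1) - f (x + h n *\<^sub>R axis j 1) + f x)"
  have conv: "\<exists>p. p \<longlonglongrightarrow> x \<and> (\<forall>n. \<Delta> i j n = h n * h n * partial j (partial i f) (p n))" for i j
  proof -
    from second_difference_eq[OF f(1) f' h, where x = x]
    have "\<forall>n. \<exists>s t. 0 < s \<and> s < h n \<and> 0 < t \<and> t < h n \<and>
      \<Delta> i j n = h n * h n * partial j (partial i f) (x + s *\<^sub>R axis i 1 + t *\<^sub>R axis j 1)"
      unfolding \<Delta>_def by blast
    then obtain s t where st: "\<And>n. 0 < s n" "\<And>n. s n < h n" "\<And>n. 0 < t n" "\<And>n. t n < h n"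
      "\<And>n. \<Delta> i j n = h n * h n * partial j (partial i f) (x + s n *\<^sub>R axis i 1 + t n *\<^sub>R axis j 1)"
      by metis
    have "s \<longlonglongrightarrow> 0"
      by (rule tendsto_sandwich[OF always_eventually always_eventually tendsto_const h0])
        (use st(1,2) less_imp_le in blast)+
    moreover have "t \<longlonglongrightarrow> 0"
      by (rule tendsto_sandwich[OF always_eventually always_eventually tendsto_const h0])
        (use st(3,4) less_imp_le in blast)+
    ultimately have "(\<lambda>n. x + s n *\<^sub>R axis i 1 + t n *\<^sub>R axis j 1) \<longlonglongrightarrow> x + 0 *\<^sub>R axis i 1 + 0 *\<^sub>R axis j 1"
      by (intro tendsto_intros)
    then show ?thesis using st(5) by (intro exI[of _ "\<lambda>n. x + s n *\<^sub>R axis i 1 + t n *\<^sub>R axis j 1"]) simp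
  qed
  have comm: "\<Delta> i j n = \<Delta> j i n" for n by (simp add: \<Delta>_def add_ac)
  obtain p q where p: "p \<longlonglongrightarrow> x" "\<And>n. \<Delta> i j n = h n * h n * partial j (partial i f) (p n)"
    and q: "q \<longlonglongrightarrow> x" "\<And>n. \<Delta> j i n = h n * h n * partial i (partial j f) (q n)"
    using conv[of i j] conv[of j i] by blast
  have "partial j (partial i f) (p n) = partial i (partial j f) (q n)" for n
    using p(2)[of n] q(2)[of n] comm[of n] h[of n] by simp
  then show ?thesis
    using LIMSEQ_unique[OF lim[OF p(1), where i = j and j = i]] lim[OF q(1), where i = i and j = j] by simp
qed

lemma partial_eq_0_outside:
  assumes "\<And>y. norm y \<ge> R \<Longrightarrow> F y = 0" "norm x > R"
  shows "partial i F x = 0"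
proof -
  have "open {y::real^'n. norm y > R}" by (intro open_Collect_less continuous_intros)
  moreover have "((\<lambda>y. 0) has_derivative (\<lambda>h. 0)) (at x)" by simp
  ultimately have "(F has_derivative (\<lambda>h. 0)) (at x)"
    using has_derivative_transform_within_open[of "\<lambda>y. 0" "\<lambda>h. 0" x UNIV "{y. norm y > R}" F] assms by auto
  from partial_eqI[OF this] show ?thesis .
qed

text \<open>The difference quotients \<open>n (F(x + e\<^sub>i/n) - F(x))\<close> have integral zero by translation invariance.\<close>
lemma integral_partial_compact_support:
  fixes F :: "real^'n \<Rightarrow> real"
  assumes F: "Ck 1 F" and supp: "\<And>x. norm x \<ge> R \<Longrightarrow> F x = 0"
  shows "integrable lborel (partial i F)" "integral\<^sup>L lborel (partial i F) = 0"
proof -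
  let ?e = "axis i 1 :: real^'n"
  have intF: "integrable lborel F"
  proof -
    have "integrable lborel (\<lambda>x. indicator (cball 0 R) x *\<^sub>R F x)"
      by (rule borel_integrable_compact) (auto intro: Ck_1_continuous[OF F])
    moreover have "(\<lambda>x. indicator (cball 0 R) x *\<^sub>R F x) = F"
      using supp by (auto simp: fun_eq_iff indicator_def)
    ultimately show ?thesis by simp
  qed
  have "compact (partial i F ` cball 0 R)"
    by (intro compact_continuous_image Ck_1_partial_continuous F) auto
  then obtain M where "\<And>y. y \<in> partial i F ` cball 0 R \<Longrightarrow> norm y \<le> M"
    by (meson compact_imp_bounded bounded_iff)
  then have M: "\<bar>partial i F x\<bar> \<le> M" if "norm x \<le> R" for x
    using that by force
  have bound: "\<bar>partial i F x\<bar> \<le> \<bar>M\<bar>" for x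
    using M[of x] partial_eq_0_outside[where F = F and x = x and i = i, OF supp] by (cases "norm x \<le> R") auto
  define q where "q = (\<lambda>n x. real (Suc n) * (F (x + (1 / real (Suc n)) *\<^sub>R ?e) - F x))"
  have shift: "integrable lborel (\<lambda>x. F (x + c)) \<and> integral\<^sup>L lborel (\<lambda>x. F (x + c)) = integral\<^sup>L lborel F" for c
  proof -
    have "integrable (distr lborel borel ((+) c)) F" using intF by (simp add: lborel_distr_plus)
    then have "integrable lborel (\<lambda>x. F (c + x))"
      by (subst (asm) integrable_distr_eq) (auto intro: borel_measurable_continuous_onI Ck_1_continuous[OF F])
    moreover have "integral\<^sup>L (distr lborel borel ((+) c)) F = integral\<^sup>L lborel (\<lambda>x. F (c + x))"
      by (rule integral_distr) (auto intro: borel_measurable_continuous_onI Ck_1_continuous[OF F])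
    ultimately show ?thesis by (simp add: lborel_distr_plus add.commute)
  qed
  have q0: "integral\<^sup>L lborel (q n) = 0" for n
    unfolding q_def using shift intF by simp
  \<comment> \<open>The shifts have length at most 1, so the quotients vanish once the norm exceeds
    R by 1. Absolute values are taken because R may be negative, and then nothing determines the
    sign of M either.\<close>
  have qb: "\<bar>q n x\<bar> \<le> \<bar>M\<bar> * indicator (cball 0 (\<bar>R\<bar> + 1)) x" for n x
  proof (cases "norm x \<le> \<bar>R\<bar> + 1")
    case True
    let ?h = "1 / real (Suc n)"
    have "\<exists>z. 0 < z \<and> z < ?h \<and> F (x + ?h *\<^sub>R ?e) - F (x + 0 *\<^sub>R ?e) = (?h - 0) * partial i F (x + z *\<^sub>R ?e)"
      using F unfolding Ck_1_iff by (intro MVT2 has_real_derivative_along_axis) auto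
    then obtain z where "F (x + ?h *\<^sub>R ?e) - F x = ?h * partial i F (x + z *\<^sub>R ?e)" by auto
    then have "q n x = partial i F (x + z *\<^sub>R ?e)" unfolding q_def by simp
    then show ?thesis using bound True by simp
  next
    case False
    have "norm ((1 / real (Suc n)) *\<^sub>R ?e) \<le> 1" by (simp add: divide_simps)
    then have "norm (x + (1 / real (Suc n)) *\<^sub>R ?e) \<ge> R"
      using norm_triangle_ineq4[of "x + (1 / real (Suc n)) *\<^sub>R ?e" "(1 / real (Suc n)) *\<^sub>R ?e"] False
      by (simp only: add_diff_cancel_right')
    then have "q n x = 0" using False supp by (simp add: q_def)
    then show ?thesis by simp
  qed
  have qlim: "(\<lambda>n. q n x) \<longlonglongrightarrow> partial i F x" for x
  proof -
    have "((\<lambda>s. F (x + s *\<^sub>R ?e)) has_real_derivative partial i F (x + 0 *\<^sub>R ?e)) (at 0)"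
      using F unfolding Ck_1_iff by (intro has_real_derivative_along_axis) auto
    then have "((\<lambda>h. (F (x + h *\<^sub>R ?e) - F x) / h) \<longlongrightarrow> partial i F x) (at 0)"
      by (simp add: DERIV_def)
    moreover have "filterlim (\<lambda>n. 1 / real (Suc n)) (at 0) sequentially"
      unfolding filterlim_at using LIMSEQ_Suc[OF lim_1_over_n[where 'a = real]] by simp
    ultimately have "(\<lambda>n. (F (x + (1 / real (Suc n)) *\<^sub>R ?e) - F x) / (1 / real (Suc n))) \<longlonglongrightarrow> partial i F x"
      by (rule filterlim_compose)
    then show ?thesis by (simp add: q_def mult.commute)
  qed
  have meas: "partial i F \<in> borel_measurable lborel" "\<And>n. q n \<in> borel_measurable lborel"
    unfolding q_def
    by (auto intro!: borel_measurable_continuous_onI continuous_intros Ck_1_partial_continuous F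
        continuous_on_compose2[OF Ck_1_continuous[OF F, of UNIV]])
  have w: "integrable lborel (\<lambda>x::real^'n. \<bar>M\<bar> * indicator (cball 0 (\<bar>R\<bar> + 1)) x)"
    by (intro integrable_mult_right integrable_real_indicator) (use emeasure_bounded_finite[OF bounded_cball] in auto)
  have dc1: "AE x in lborel. (\<lambda>n. q n x) \<longlonglongrightarrow> partial i F x" using qlim by simp
  have dc2: "AE x in lborel. norm (q n x) \<le> \<bar>M\<bar> * indicator (cball 0 (\<bar>R\<bar> + 1)) x" for n using qb by simp
  show "integrable lborel (partial i F)"
    by (rule integrable_dominated_convergence[OF meas w dc1 dc2])
  have "(\<lambda>n. integral\<^sup>L lborel (q n)) \<longlonglongrightarrow> integral\<^sup>L lborel (partial i F)"
    by (rule integral_dominated_convergence[OF meas w dc1 dc2])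
  then show "integral\<^sup>L lborel (partial i F) = 0"
    using LIMSEQ_unique[OF _ tendsto_const] by (simp add: q0)
qed

section \<open>Cutoff functions\<close>

definition cutoff :: "real \<Rightarrow> real^'n \<Rightarrow> real" where
  "cutoff R x = (max 0 (1 - (x \<bullet> x) / R))\<^sup>2"

text \<open>The reason for the square in \<open>cutoff\<close>: squaring the truncation makes the
  derivative continuous across the boundary of the support.\<close>

lemma max_0_square_has_derivative: "((\<lambda>t. (max 0 t)\<^sup>2) has_real_derivative 2 * max 0 t) (at t)"
proof -
  consider "t < 0" | "t > 0" | "t = 0" by linarith
  then show ?thesis
  proof cases
    case 1
    have "((\<lambda>t. 0) has_real_derivative 0) (at t)" by simp
    then have "((\<lambda>t. (max 0 t)\<^sup>2) has_real_derivative 0) (at t)"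
      by (rule has_field_derivative_transform_within_open[of _ _ _ "{..<0}"]) (use 1 in auto)
    then show ?thesis using 1 by simp
  next
    case 2
    have "((\<lambda>t. t\<^sup>2) has_real_derivative 2 * t) (at t)" by (auto intro!: derivative_eq_intros)
    then have "((\<lambda>t. (max 0 t)\<^sup>2) has_real_derivative 2 * t) (at t)"
      by (rule has_field_derivative_transform_within_open[of _ _ _ "{0<..}"]) (use 2 in auto)
    then show ?thesis using 2 by simp
  next
    case 3
    have "((\<lambda>h::real. (max 0 h)\<^sup>2 / h) \<longlongrightarrow> 0) (at 0)"
    proof (rule Lim_null_comparison)
      show "\<forall>\<^sub>F h in at 0. norm ((max 0 h)\<^sup>2 / h) \<le> \<bar>h::real\<bar>"
        by (intro always_eventually) (auto simp: max_def power2_eq_square)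
      show "((\<lambda>h::real. \<bar>h\<bar>) \<longlongrightarrow> 0) (at 0)" by (auto intro!: tendsto_eq_intros)
    qed
    then show ?thesis using 3 by (simp add: DERIV_def)
  qed
qed

lemma cutoff_has_derivative:
  "(cutoff R has_derivative (\<lambda>h. - 4 * max 0 (1 - (x \<bullet> x) / R) * (x \<bullet> h) / R)) (at x)"
proof -
  have "((\<lambda>x. 1 - (x \<bullet> x) / R) has_derivative (\<lambda>h. - (2 * (x \<bullet> h) / R))) (at x)"
    unfolding divide_inverse by (auto intro!: derivative_eq_intros simp: inner_commute algebra_simps)
  from has_derivative_compose[OF this max_0_square_has_derivative[unfolded has_field_derivative_def]]
  show ?thesis
    unfolding cutoff_def[abs_def] by (rule has_derivative_eq_rhs) (simp add: fun_eq_iff)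
qed

lemma Ck_1_cutoff:
  assumes "R > 0"
  shows "Ck 1 (cutoff R :: real^'n \<Rightarrow> real)"
proof (rule Ck_1I[OF cutoff_has_derivative])
  fix i :: 'n
  have "R \<noteq> 0" using assms by simp
  then show "continuous_on UNIV (\<lambda>x. - 4 * max 0 (1 - x \<bullet> x / R) * (x \<bullet> axis i 1) / R)"
    by (intro continuous_intros) auto
qed

lemma cutoff_bounds:
  assumes "R > 0"
  shows "0 \<le> cutoff R x" "cutoff R x \<le> 1"
proof -
  have "(x \<bullet> x) / R \<ge> 0" using assms by simp
  then show "0 \<le> cutoff R x" "cutoff R x \<le> 1"
    unfolding cutoff_def by (auto intro!: power_le_one)
qed

lemma cutoff_eq_0:
  assumes "R \<ge> 1" "norm x \<ge> R"
  shows "cutoff R x = 0"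
proof -
  \<comment> \<open>R scales the squared norm, so the support is the ball of radius sqrt R, which R
    >= 1 places inside the ball of radius R.\<close>
  have "R * 1 \<le> norm x * norm x" using assms by (intro mult_mono) auto
  then have "1 - (x \<bullet> x) / R \<le> 0" using assms by (simp add: divide_simps power2_eq_square dot_square_norm)
  then show ?thesis by (simp add: cutoff_def)
qed

lemma cutoff_tendsto: "(\<lambda>n. cutoff (real (Suc n)) x) \<longlonglongrightarrow> 1"
proof -
  have "(\<lambda>n. (x \<bullet> x) * (1 / real (Suc n))) \<longlonglongrightarrow> (x \<bullet> x) * 0"
    by (intro tendsto_intros LIMSEQ_Suc[OF lim_1_over_n])
  then have "(\<lambda>n. (max 0 (1 - (x \<bullet> x) * (1 / real (Suc n))))\<^sup>2) \<longlonglongrightarrow> (max 0 (1 - (x \<bullet> x) * 0))\<^sup>2"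
    by (intro tendsto_power tendsto_max tendsto_diff tendsto_const)
  then show ?thesis by (simp add: cutoff_def)
qed

lemma partial_cutoff_bound:
  assumes "R > 0"
  shows "\<bar>partial i (cutoff R) x\<bar> \<le> 4 * norm x / R"
proof -
  have "partial i (cutoff R) x = - 4 * max 0 (1 - (x \<bullet> x) / R) * (x \<bullet> axis i 1) / R"
    by (rule partial_eqI[OF cutoff_has_derivative])
  then have "\<bar>partial i (cutoff R) x\<bar> = 4 * (max 0 (1 - (x \<bullet> x) / R) * \<bar>x $ i\<bar>) / R"
    using assms by (simp add: abs_mult inner_axis)
  also have "\<dots> \<le> 4 * (1 * norm x) / R"
    using assms by (intro divide_right_mono mult_left_mono mult_mono component_le_norm_cart) auto
  finally show ?thesis by simp
qed

lemma partial_cutoff_tendsto: "(\<lambda>n. partial i (cutoff (real (Suc n))) x) \<longlonglongrightarrow> 0"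
proof (rule Lim_null_comparison)
  show "\<forall>\<^sub>F n in sequentially. norm (partial i (cutoff (real (Suc n))) x) \<le> 4 * norm x * (1 / real (Suc n))"
    using partial_cutoff_bound[where R = "real (Suc n)" and i = i and x = x for n] by (intro always_eventually allI) simp
  have "(\<lambda>n. 4 * norm x * (1 / real (Suc n))) \<longlonglongrightarrow> 4 * norm x * 0"
    by (intro tendsto_intros LIMSEQ_Suc[OF lim_1_over_n])
  then show "(\<lambda>n. 4 * norm x * (1 / real (Suc n))) \<longlonglongrightarrow> 0" by simp
qed

section \<open>Growth at infinity and Gaussian integrals\<close>

definition poly_bounded_on :: "(real^'n) set \<Rightarrow> (real^'n \<Rightarrow> real) \<Rightarrow> bool" where
  "poly_bounded_on S f \<longleftrightarrow> (\<exists>C m. C \<ge> 0 \<and> (\<forall>x\<in>S. \<bar>f x\<bar> \<le> C * (1 + norm x) ^ m))"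

lemma poly_bounded_onI: "C \<ge> 0 \<Longrightarrow> (\<And>x. x \<in> S \<Longrightarrow> \<bar>f x\<bar> \<le> C * (1 + norm x) ^ m) \<Longrightarrow> poly_bounded_on S f"
  unfolding poly_bounded_on_def by blast

lemma poly_bounded_on_const: "poly_bounded_on S (\<lambda>x. c)"
  by (rule poly_bounded_onI[of "\<bar>c\<bar>" _ _ 0]) auto

lemma poly_bounded_on_norm: "poly_bounded_on S norm"
  by (rule poly_bounded_onI[of 1 _ _ 1]) auto

lemma poly_bounded_on_mono:
  assumes "poly_bounded_on S g" "\<And>x. x \<in> S \<Longrightarrow> \<bar>f x\<bar> \<le> \<bar>g x\<bar>"
  shows "poly_bounded_on S f"
  using assms unfolding poly_bounded_on_def by (meson order_trans)

lemma poly_bounded_on_coord: "poly_bounded_on S (\<lambda>x. x $ i)"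
  by (rule poly_bounded_on_mono[OF poly_bounded_on_norm]) (simp add: component_le_norm_cart)

lemma poly_bounded_on_add:
  assumes "poly_bounded_on S f" "poly_bounded_on S g"
  shows "poly_bounded_on S (\<lambda>x. f x + g x)"
proof -
  obtain C m where f: "C \<ge> 0" "\<And>x. x \<in> S \<Longrightarrow> \<bar>f x\<bar> \<le> C * (1 + norm x) ^ m" using assms(1) unfolding poly_bounded_on_def by blast
  obtain D l where g: "D \<ge> 0" "\<And>x. x \<in> S \<Longrightarrow> \<bar>g x\<bar> \<le> D * (1 + norm x) ^ l" using assms(2) unfolding poly_bounded_on_def by blast
  show ?thesis
  proof (rule poly_bounded_onI)
    fix x assume x: "x \<in> S"
    have "C * (1 + norm x) ^ m \<le> C * (1 + norm x) ^ (m + l)" "D * (1 + norm x) ^ l \<le> D * (1 + norm x) ^ (m + l)"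
      using f(1) g(1) by (intro mult_left_mono power_increasing; simp)+
    then show "\<bar>f x + g x\<bar> \<le> (C + D) * (1 + norm x) ^ (m + l)"
      using f(2)[OF x] g(2)[OF x] by (simp add: distrib_right)
  qed (use f g in simp)
qed

lemma poly_bounded_on_mult:
  assumes "poly_bounded_on S f" "poly_bounded_on S g"
  shows "poly_bounded_on S (\<lambda>x. f x * g x)"
proof -
  obtain C m where f: "C \<ge> 0" "\<And>x. x \<in> S \<Longrightarrow> \<bar>f x\<bar> \<le> C * (1 + norm x) ^ m" using assms(1) unfolding poly_bounded_on_def by blast
  obtain D l where g: "D \<ge> 0" "\<And>x. x \<in> S \<Longrightarrow> \<bar>g x\<bar> \<le> D * (1 + norm x) ^ l" using assms(2) unfolding poly_bounded_on_def by blast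
  show ?thesis
  proof (rule poly_bounded_onI)
    fix x assume x: "x \<in> S"
    have "\<bar>f x * g x\<bar> \<le> (C * (1 + norm x) ^ m) * (D * (1 + norm x) ^ l)"
      unfolding abs_mult using f g x by (intro mult_mono) auto
    then show "\<bar>f x * g x\<bar> \<le> (C * D) * (1 + norm x) ^ (m + l)"
      by (simp add: power_add mult_ac)
  qed (use f g in simp)
qed

lemma poly_bounded_on_sum:
  assumes "\<And>a. a \<in> A \<Longrightarrow> poly_bounded_on S (f a)"
  shows "poly_bounded_on S (\<lambda>x. \<Sum>a\<in>A. f a x)"
  using assms by (induction A rule: infinite_finite_induct) (auto intro: poly_bounded_on_add poly_bounded_on_const)

lemma poly_bounded_on_uminus: "poly_bounded_on S f \<Longrightarrow> poly_bounded_on S (\<lambda>x. - f x)"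
  by (erule poly_bounded_on_mono) simp

lemma poly_bounded_on_diff:
  "poly_bounded_on S f \<Longrightarrow> poly_bounded_on S g \<Longrightarrow> poly_bounded_on S (\<lambda>x. f x - g x)"
  using poly_bounded_on_add[OF _ poly_bounded_on_uminus, of S f g] by simp

lemma poly_bounded_on_abs: "poly_bounded_on S f \<Longrightarrow> poly_bounded_on S (\<lambda>x. \<bar>f x\<bar>)"
  by (erule poly_bounded_on_mono) simp

lemmas poly_bounded_on_intros = poly_bounded_on_const poly_bounded_on_norm poly_bounded_on_coord
  poly_bounded_on_add poly_bounded_on_mult poly_bounded_on_sum poly_bounded_on_uminus poly_bounded_on_diff
  poly_bounded_on_abs

lemma poly_bounded_UNIV:
  fixes f :: "real^'n \<Rightarrow> real"
  assumes "continuous_on UNIV f" "poly_bounded_on {x. norm x \<ge> 1} f"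
  shows "poly_bounded_on UNIV f"
proof -
  obtain C m where f: "C \<ge> 0" "\<And>x. norm x \<ge> 1 \<Longrightarrow> \<bar>f x\<bar> \<le> C * (1 + norm x) ^ m"
    using assms(2) unfolding poly_bounded_on_def by blast
  have "compact (f ` cball 0 1)"
    using assms(1) by (intro compact_continuous_image) (auto intro: continuous_on_subset)
  then obtain M where "\<And>y. y \<in> f ` cball 0 1 \<Longrightarrow> norm y \<le> M"
    by (meson compact_imp_bounded bounded_iff)
  then have M: "\<bar>f x\<bar> \<le> M" if "norm x \<le> 1" for x using that by force
  show ?thesis
  proof (rule poly_bounded_onI)
    fix x :: "real^'n"
    have p: "1 \<le> (1 + norm x) ^ m" by simp
    show "\<bar>f x\<bar> \<le> (\<bar>M\<bar> + C) * (1 + norm x) ^ m"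
    proof (cases "norm x \<le> 1")
      case True
      have "\<bar>M\<bar> * 1 \<le> (\<bar>M\<bar> + C) * (1 + norm x) ^ m" using p f(1) by (intro mult_mono) auto
      then show ?thesis using M[OF True] by simp
    next
      case False
      have "C * (1 + norm x) ^ m \<le> (\<bar>M\<bar> + C) * (1 + norm x) ^ m" using f(1) by (intro mult_right_mono) auto
      moreover have "\<bar>f x\<bar> \<le> C * (1 + norm x) ^ m" using f(2)[of x] False by simp
      ultimately show ?thesis by linarith
    qed
  qed (use f in simp)
qed

text \<open>The origin is excluded because inversion is singular there, and bounds are asked only on
  norm >= 1, which inversion maps into the compact unit ball. Including the partial derivatives
  keeps the class closed under products and lets it be applied to \<phi> and to each
  \<open>partial i \<phi>\<close>, covering two derivatives of \<phi>.\<close>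

definition poly_growth1 :: "(real^'n \<Rightarrow> real) \<Rightarrow> bool" where
  "poly_growth1 f \<longleftrightarrow> (\<forall>x. x \<noteq> 0 \<longrightarrow> f differentiable (at x)) \<and> poly_bounded_on {x. norm x \<ge> 1} f
     \<and> (\<forall>i. poly_bounded_on {x. norm x \<ge> 1} (partial i f))"

lemma poly_growth1I:
  assumes "\<And>x. x \<noteq> 0 \<Longrightarrow> (f has_derivative f' x) (at x)" "poly_bounded_on {x. norm x \<ge> 1} f"
    "\<And>i. poly_bounded_on {x. norm x \<ge> 1} (\<lambda>x. f' x (axis i 1))"
  shows "poly_growth1 f"
  unfolding poly_growth1_def
proof (intro conjI allI impI)
  show "f differentiable (at x)" if "x \<noteq> 0" for x using assms(1)[OF that] differentiable_def by blast
  show "poly_bounded_on {x. norm x \<ge> 1} (partial i f)" for i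
  proof (rule poly_bounded_on_mono[OF assms(3)[of i]])
    fix x :: "real^'a" assume "x \<in> {x. norm x \<ge> 1}"
    then have "x \<noteq> 0" by auto
    from partial_eqI[OF assms(1)[OF this]] show "\<bar>partial i f x\<bar> \<le> \<bar>f' x (axis i 1)\<bar>" by simp
  qed
qed (fact assms)

lemma poly_growth1D:
  assumes "poly_growth1 f"
  shows "x \<noteq> 0 \<Longrightarrow> (f has_derivative frechet_derivative f (at x)) (at x)"
    and "poly_bounded_on {x. norm x \<ge> 1} f" and "poly_bounded_on {x. norm x \<ge> 1} (partial i f)"
  using assms frechet_derivative_works unfolding poly_growth1_def by blast+

lemma poly_growth1_cong:
  assumes "poly_growth1 f" "\<And>x. x \<noteq> 0 \<Longrightarrow> h x = f x"
  shows "poly_growth1 h"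
proof (rule poly_growth1I)
  fix x :: "real^'a" assume x: "x \<noteq> 0"
  have "open (- {0::real^'a})" by auto
  then show "(h has_derivative frechet_derivative f (at x)) (at x)"
    using has_derivative_transform_within_open[OF poly_growth1D(1)[OF assms(1) x], of "- {0}" h] x assms(2) by auto
next
  show "poly_bounded_on {x. norm x \<ge> 1} h"
  proof (rule poly_bounded_on_mono[OF poly_growth1D(2)[OF assms(1)]])
    fix x :: "real^'a" assume "x \<in> {x. norm x \<ge> 1}"
    then have "x \<noteq> 0" by auto
    then show "\<bar>h x\<bar> \<le> \<bar>f x\<bar>" by (simp add: assms(2))
  qed
qed (rule poly_growth1D(3)[OF assms(1)])

lemma poly_growth1_const: "poly_growth1 (\<lambda>x. c)"
  by (rule poly_growth1I[where f' = "\<lambda>x h. 0"]) (auto intro: poly_bounded_on_intros)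

lemma poly_growth1_coord: "poly_growth1 (\<lambda>x. x $ i)"
  by (rule poly_growth1I[where f' = "\<lambda>x h. h $ i"])
     (auto intro!: poly_bounded_on_intros bounded_linear_imp_has_derivative bounded_linear_vec_nth)

lemma poly_growth1_add:
  assumes "poly_growth1 f" "poly_growth1 g"
  shows "poly_growth1 (\<lambda>x. f x + g x)"
  by (rule poly_growth1I[OF has_derivative_add[OF assms[THEN poly_growth1D(1)]]])
     (auto intro!: poly_bounded_on_intros assms[THEN poly_growth1D(2)] assms[THEN poly_growth1D(3)])

lemma poly_growth1_mult:
  assumes "poly_growth1 f" "poly_growth1 g"
  shows "poly_growth1 (\<lambda>x. f x * g x)"
  by (rule poly_growth1I[OF has_derivative_mult[OF assms[THEN poly_growth1D(1)]]])
     (auto intro!: poly_bounded_on_intros assms[THEN poly_growth1D(2)] assms[THEN poly_growth1D(3)])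

lemma poly_growth1_sum:
  assumes "\<And>a. a \<in> A \<Longrightarrow> poly_growth1 (f a)"
  shows "poly_growth1 (\<lambda>x. \<Sum>a\<in>A. f a x)"
  using assms by (induction A rule: infinite_finite_induct) (auto intro: poly_growth1_add poly_growth1_const)

lemma poly_bounded_on_inverse_square: "poly_bounded_on {x. norm x \<ge> 1} (\<lambda>x. inverse (x \<bullet> x))"
proof (rule poly_bounded_onI[of 1 _ _ 0])
  fix x :: "real^'n" assume "x \<in> {x. norm x \<ge> 1}"
  then have "x \<bullet> x \<ge> 1" by (simp add: dot_square_norm)
  then show "\<bar>inverse (x \<bullet> x)\<bar> \<le> 1 * (1 + norm x) ^ 0" by (simp add: inverse_le_1_iff)
qed simp

lemma inner_self_has_derivative: "((\<lambda>x. x \<bullet> x) has_derivative (\<lambda>h. 2 * (x \<bullet> h))) (at x)"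
  by (auto intro!: derivative_eq_intros simp: inner_commute)

lemma poly_growth1_inverse_square: "poly_growth1 (\<lambda>x::real^'n. inverse (x \<bullet> x))"
proof (rule poly_growth1I[where f' = "\<lambda>x h. - 2 * (x \<bullet> h) * (inverse (x \<bullet> x) * inverse (x \<bullet> x))"])
  fix x :: "real^'n" assume "x \<noteq> 0"
  then have "x \<bullet> x \<noteq> 0" by simp
  from Deriv.has_derivative_inverse[OF this inner_self_has_derivative]
  show "((\<lambda>x. inverse (x \<bullet> x)) has_derivative (\<lambda>h. - 2 * (x \<bullet> h) * (inverse (x \<bullet> x) * inverse (x \<bullet> x)))) (at x)"
    by (rule has_derivative_eq_rhs) (simp add: fun_eq_iff mult_ac)
next
  fix i :: 'n
  show "poly_bounded_on {x. norm x \<ge> 1} (\<lambda>x. - 2 * (x \<bullet> axis i 1) * (inverse (x \<bullet> x) * inverse (x \<bullet> x)))"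
    unfolding inner_axis by (simp; intro poly_bounded_on_intros poly_bounded_on_inverse_square)
qed (rule poly_bounded_on_inverse_square)

section \<open>Inversion in the unit sphere and growth at infinity\<close>

definition inversion :: "real^'n \<Rightarrow> real^'n" where
  "inversion x = inverse (x \<bullet> x) *\<^sub>R x"

lemma norm_inversion: "norm (inversion x) = inverse (norm x)"
  by (cases "x = 0") (simp_all add: inversion_def dot_square_norm power2_eq_square)

text \<open>Valid at 0 as well: \<open>inverse 0 = 0\<close> makes 0 a fixed point of
  \<open>inversion\<close>.\<close>

lemma inversion_inversion: "inversion (inversion x) = x"
  by (cases "x = 0") (simp_all add: inversion_def power2_eq_square)

lemma inversion_has_derivative:
  assumes "x \<noteq> 0"
  shows "(inversion has_derivative
    (\<lambda>h. inverse (x \<bullet> x) *\<^sub>R h - (2 * (x \<bullet> h) * (inverse (x \<bullet> x) * inverse (x \<bullet> x))) *\<^sub>R x)) (at x)"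
  unfolding inversion_def[abs_def]
  using assms by (auto intro!: derivative_eq_intros simp: inner_commute algebra_simps)

lemma partial_compose_inversion:
  fixes g :: "real^'n \<Rightarrow> real"
  assumes g: "Ck 1 g" and x: "x \<noteq> 0"
  shows "((\<lambda>x. g (inversion x)) has_derivative (\<lambda>h. \<Sum>j\<in>UNIV. (inverse (x \<bullet> x) * h $ j
     + (- 2) * (x \<bullet> h) * (inverse (x \<bullet> x) * inverse (x \<bullet> x)) * x $ j) * partial j g (inversion x))) (at x)"
proof -
  have "g differentiable (at (inversion x))" using g Ck_1_iff by blast
  from has_derivative_compose[OF inversion_has_derivative[OF x] has_derivative_sum_partial[OF this]]
  show ?thesis by simp
qed

text \<open>For norm x >= 1 the inverted point stays in the unit ball, where g and its partial
  derivatives are bounded by compactness; the chain rule adds only coordinates and powers of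
  \<open>inverse (x \<bullet> x)\<close>, which is at most 1.\<close>

lemma poly_growth1_compose_inversion:
  fixes g :: "real^'n \<Rightarrow> real"
  assumes g: "Ck 1 g"
  shows "poly_growth1 (\<lambda>x. g (inversion x))"
proof (rule poly_growth1I[OF partial_compose_inversion[OF g]])
  have inv: "inversion x \<in> cball 0 1" if "norm x \<ge> 1" for x :: "real^'n"
    using that by (simp add: norm_inversion inverse_le_1_iff)
  have bd: "poly_bounded_on {x. norm x \<ge> 1} (\<lambda>x. f (inversion x))" if "continuous_on (cball 0 1) f" for f :: "real^'n \<Rightarrow> real"
  proof -
    have "compact (f ` cball 0 1)" using that by (intro compact_continuous_image) auto
    then obtain M where "\<And>y. y \<in> f ` cball 0 1 \<Longrightarrow> norm y \<le> M"
      by (meson compact_imp_bounded bounded_iff)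
    then have M: "\<bar>f x\<bar> \<le> M" if "x \<in> cball 0 1" for x using that by force
    show ?thesis
      by (rule poly_bounded_onI[of "\<bar>M\<bar>" _ _ 0]) (use M inv in \<open>fastforce simp: abs_le_iff\<close>)+
  qed
  show "poly_bounded_on {x. norm x \<ge> 1} (\<lambda>x. g (inversion x))"
    by (rule bd) (rule Ck_1_continuous[OF g])
  show "poly_bounded_on {x. norm x \<ge> 1} (\<lambda>x. \<Sum>j\<in>UNIV. (inverse (x \<bullet> x) * axis i 1 $ j
     + (- 2) * (x \<bullet> axis i 1) * (inverse (x \<bullet> x) * inverse (x \<bullet> x)) * x $ j) * partial j g (inversion x))" for i
    unfolding inner_axis
    by (simp del: vector_component; intro poly_bounded_on_intros poly_bounded_on_inverse_square bd Ck_1_partial_continuous g)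
qed

lemma poly_growth1_square: "poly_growth1 (\<lambda>x. x \<bullet> x)"
  unfolding inner_vec_def inner_real_def
  by (intro poly_growth1_sum poly_growth1_mult poly_growth1_coord)

text \<open>The first derivatives of \<phi> are built from coordinates, g and the partial
  derivatives of g at the inverted point. These compositions have C^1 outer functions, so one
  further derivative is controlled: exactly what a C^2 extension provides.\<close>

lemma growth_of_inverted:
  fixes \<phi> g :: "real^'n \<Rightarrow> real"
  assumes g: "Ck 2 g" and eq: "\<And>x. x \<noteq> 0 \<Longrightarrow> \<phi> x = (x \<bullet> x) * g (inversion x)"
  shows "poly_growth1 \<phi>" "poly_growth1 (partial i \<phi>)"
proof -
  have g1: "Ck 1 g" "\<And>i. Ck 1 (partial i g)"
    using g Ck_SucD[of 1 g] Ck_Suc_iff[of 1 g] by (simp_all add: numeral_2_eq_2)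
  show "poly_growth1 \<phi>"
    by (rule poly_growth1_cong[OF _ eq])
       (intro poly_growth1_mult poly_growth1_square poly_growth1_compose_inversion g1)
  let ?d = "\<lambda>x. 2 * x $ i * g (inversion x) + (x \<bullet> x) * (\<Sum>j\<in>UNIV. (inverse (x \<bullet> x) * axis i 1 $ j
     + (- 2) * x $ i * (inverse (x \<bullet> x) * inverse (x \<bullet> x)) * x $ j) * partial j g (inversion x))"
  show "poly_growth1 (partial i \<phi>)"
  proof (rule poly_growth1_cong)
    show "poly_growth1 ?d"
      by (intro poly_growth1_add poly_growth1_mult poly_growth1_sum poly_growth1_square poly_growth1_inverse_square
          poly_growth1_compose_inversion g1 poly_growth1_const poly_growth1_coord)
    fix x :: "real^'n" assume x: "x \<noteq> 0"
    have "open (- {0::real^'n})" by auto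
    from has_derivative_transform_within_open[OF has_derivative_mult[OF inner_self_has_derivative partial_compose_inversion[OF g1(1) x]] this]
    have "(\<phi> has_derivative (\<lambda>h. (x \<bullet> x) * (\<Sum>j\<in>UNIV. (inverse (x \<bullet> x) * h $ j
     + (- 2) * (x \<bullet> h) * (inverse (x \<bullet> x) * inverse (x \<bullet> x)) * x $ j) * partial j g (inversion x))
       + 2 * (x \<bullet> h) * g (inversion x))) (at x)"
      using x eq by auto
    from partial_eqI[OF this, of i] show "partial i \<phi> x = ?d x"
      by (simp add: inner_axis)
  qed
qed

text \<open>Continuity keeps g above g(0)/2 on a ball of radius d around 0, which corresponds to the
  region norm x > 1/d; on the remaining compact ball the constant K absorbs both \<phi> and the
  quadratic term.\<close>

lemma lower_bound_of_inverted:
  fixes \<phi> g :: "real^'n \<Rightarrow> real"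
  assumes g: "continuous_on UNIV g" and eq: "\<And>x. x \<noteq> 0 \<Longrightarrow> \<phi> x = (x \<bullet> x) * g (inversion x)"
    and g0: "g 0 > 0" and \<phi>: "continuous_on UNIV \<phi>"
  shows "\<exists>c K. c > 0 \<and> (\<forall>x. \<phi> x \<ge> c * (norm x)\<^sup>2 - K)"
proof -
  define c where "c = g 0 / 2"
  have c: "c > 0" using g0 by (simp add: c_def)
  have "isCont g 0" using g by (simp add: continuous_on_eq_continuous_at)
  then obtain d where d: "d > 0" "\<And>y. norm y < d \<Longrightarrow> norm (g y - g 0) < c"
    unfolding continuous_at_eps_delta using c by (metis diff_zero dist_norm)
  have "compact (\<phi> ` cball 0 (inverse d))"
    using \<phi> by (intro compact_continuous_image) (auto intro: continuous_on_subset)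
  then obtain M where "\<And>y. y \<in> \<phi> ` cball 0 (inverse d) \<Longrightarrow> norm y \<le> M"
    by (meson compact_imp_bounded bounded_iff)
  then have M: "\<bar>\<phi> x\<bar> \<le> M" if "norm x \<le> inverse d" for x using that by force
  have "\<phi> x \<ge> c * (norm x)\<^sup>2 - (\<bar>M\<bar> + c * (inverse d)\<^sup>2)" for x
  proof (cases "norm x \<le> inverse d")
    case True
    have "c * (norm x)\<^sup>2 \<le> c * (inverse d)\<^sup>2" using True c by (intro mult_left_mono power_mono) auto
    then show ?thesis using M[OF True] by linarith
  next
    case False
    then have x: "x \<noteq> 0" using d(1) by auto
    have "norm (inversion x) < d"
      using less_imp_inverse_less[of "inverse d" "norm x"] False d(1) by (simp add: norm_inversion)
    then have "g (inversion x) \<ge> c" using d(2)[of "inversion x"] unfolding c_def real_norm_def by linarith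
    then have "(x \<bullet> x) * c \<le> \<phi> x" unfolding eq[OF x] by (intro mult_left_mono) auto
    moreover have "c * (inverse d)\<^sup>2 \<ge> 0" using c by simp
    ultimately show ?thesis by (simp add: dot_square_norm mult.commute)
  qed
  then show ?thesis using c by blast
qed

section \<open>Gaussian integrals\<close>

lemma has_bochner_integral_gaussian:
  fixes x0 :: "real^'n"
  assumes a: "a > 0"
  shows "has_bochner_integral lborel (\<lambda>x. exp (- a * (norm (x - x0))\<^sup>2)) (sqrt (pi / a) ^ CARD('n))"
proof (rule has_bochner_integral_nn_integral)
  have g1: "(\<integral>\<^sup>+t. ennreal (exp (- a * (t - m)\<^sup>2)) \<partial>lborel) = ennreal (sqrt (pi / a))" for m :: real
  proof -
    \<comment> \<open>The standard deviation for which the normal density has exponent -a (t -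
      m)^2.\<close>
    define s where "s = sqrt (1 / (2 * a))"
    have s: "s > 0" "s\<^sup>2 = 1 / (2 * a)" using a by (simp_all add: s_def)
    have eq: "exp (- a * (t - m)\<^sup>2) = sqrt (pi / a) * normal_density m s t" for t
      unfolding normal_density_def s(2) using a by (simp add: real_sqrt_divide field_simps)
    have "(\<integral>\<^sup>+t. ennreal (sqrt (pi / a) * normal_density m s t) \<partial>lborel) = ennreal (\<integral>t. sqrt (pi / a) * normal_density m s t \<partial>lborel)"
      using s a by (intro nn_integral_eq_integral) auto
    then show ?thesis unfolding eq using s by simp
  qed
  have eq: "exp (- a * (norm (x - x0))\<^sup>2) = (\<Prod>b\<in>Basis. exp (- a * (x \<bullet> b - x0 \<bullet> b)\<^sup>2))" for x
  proof -
    have "(norm (x - x0))\<^sup>2 = (\<Sum>b\<in>Basis. (x \<bullet> b - x0 \<bullet> b)\<^sup>2)"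
      unfolding dot_square_norm[symmetric] by (subst euclidean_inner) (simp add: inner_diff_left power2_eq_square)
    then show ?thesis by (simp add: exp_sum[symmetric] sum_distrib_left sum_negf)
  qed
  have "(\<integral>\<^sup>+x. ennreal (exp (- a * (norm (x - x0))\<^sup>2)) \<partial>lborel)
     = (\<integral>\<^sup>+x. (\<Prod>b\<in>Basis. ennreal (exp (- a * (x \<bullet> b - x0 \<bullet> b)\<^sup>2))) \<partial>lborel)"
    unfolding eq by (simp add: prod_ennreal)
  also have "\<dots> = (\<Prod>b\<in>(Basis::(real^'n) set). ennreal (sqrt (pi / a)))"
    by (subst nn_integral_lborel_prod) (simp_all add: g1[unfolded mult_minus_left])
  also have "\<dots> = ennreal (sqrt (pi / a) ^ CARD('n))"
    using a by (simp add: ennreal_power)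
  finally show "(\<integral>\<^sup>+x. ennreal (exp (- a * (norm (x - x0))\<^sup>2)) \<partial>lborel) = ennreal (sqrt (pi / a) ^ CARD('n))" .
qed (use a in auto)

text \<open>Half of the Gaussian decay pays for the polynomial factor: (1 + t)^m is at most exp (m
  t), and completing the square bounds m t by m^2 / (2 c) + (c / 2) t^2. This is the origin of the
  constant in B and of the remaining exponent c / 2.\<close>

lemma integrable_poly_bounded_mult_exp:
  fixes f \<phi> :: "real^'n \<Rightarrow> real"
  assumes f: "continuous_on UNIV f" "poly_bounded_on UNIV f"
    and \<phi>: "continuous_on UNIV \<phi>" and c: "c > 0" and low: "\<And>x. \<phi> x \<ge> c * (norm x)\<^sup>2 - K"
  shows "integrable lborel (\<lambda>x. f x * exp (- \<phi> x))"
proof -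
  obtain C m where Cm: "C \<ge> 0" "\<And>x. \<bar>f x\<bar> \<le> C * (1 + norm x) ^ m"
    using f(2) unfolding poly_bounded_on_def by blast
  define B where "B = C * exp (K + (real m)\<^sup>2 / (2 * c))"
  have "integrable lborel (\<lambda>x::real^'n. B * exp (- (c / 2) * (norm (x - 0))\<^sup>2))"
    using c by (intro integrable_mult_right integrable.intros[OF has_bochner_integral_gaussian]) auto
  then show ?thesis
  proof (rule Bochner_Integration.integrable_bound)
    show "(\<lambda>x. f x * exp (- \<phi> x)) \<in> borel_measurable lborel"
      using f(1) \<phi> by (auto intro!: borel_measurable_continuous_onI continuous_intros)
    have "norm (f x * exp (- \<phi> x)) \<le> norm (B * exp (- (c / 2) * (norm (x - 0))\<^sup>2))" for x
    proof -
      let ?t = "norm x"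
      have "(1 + ?t) ^ m \<le> exp ?t ^ m" by (intro power_mono exp_ge_add_one_self) auto
      also have "\<dots> = exp (real m * ?t)" by (simp add: exp_of_nat_mult)
      finally have 1: "(1 + ?t) ^ m \<le> exp (real m * ?t)" .
      have "0 \<le> (real m - c * ?t)\<^sup>2 / (2 * c)" using c by simp
      also have "\<dots> = (real m)\<^sup>2 / (2 * c) - real m * ?t + (c / 2) * ?t\<^sup>2"
        using c by (simp add: power2_eq_square field_simps)
      finally have 2: "real m * ?t \<le> (real m)\<^sup>2 / (2 * c) + (c / 2) * ?t\<^sup>2" by linarith
      have "norm (f x * exp (- \<phi> x)) \<le> (C * exp (real m * ?t)) * exp (K - c * ?t\<^sup>2)"
      proof -
        have "\<bar>f x\<bar> \<le> C * exp (real m * ?t)"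
          by (rule order_trans[OF Cm(2) mult_left_mono[OF 1 Cm(1)]])
        moreover have "exp (- \<phi> x) \<le> exp (K - c * ?t\<^sup>2)" using low[of x] by simp
        ultimately show ?thesis unfolding real_norm_def abs_mult abs_exp_cancel
          by (intro mult_mono) (use Cm(1) in auto)
      qed
      also have "\<dots> = C * exp (real m * ?t + K - c * ?t\<^sup>2)" by (simp add: exp_add[symmetric] algebra_simps)
      also have "\<dots> \<le> C * exp (K + (real m)\<^sup>2 / (2 * c) + - (c / 2) * ?t\<^sup>2)"
        using 2 Cm(1) by (intro mult_left_mono) auto
      also have "\<dots> = B * exp (- (c / 2) * ?t\<^sup>2)"
        unfolding B_def by (simp only: exp_add mult.assoc)
      also have "\<dots> \<le> norm (B * exp (- (c / 2) * (norm (x - 0))\<^sup>2))"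
        by simp
      finally show ?thesis .
    qed
    then show "AE x in lborel. norm (f x * exp (- \<phi> x)) \<le> norm (B * exp (- (c / 2) * (norm (x - 0))\<^sup>2))"
      by simp
  qed
qed

section \<open>Rigidity of flat densities\<close>

lemma has_derivative_vec_lambda:
  fixes f :: "'i::finite \<Rightarrow> 'a::real_normed_vector \<Rightarrow> 'b::real_normed_vector"
  assumes "\<And>i. (f i has_derivative f' i) F"
  shows "((\<lambda>x. \<chi> i. f i x) has_derivative (\<lambda>h. \<chi> i. f' i h)) F"
proof -
  have bl: "bounded_linear (axis i :: 'b \<Rightarrow> 'b^'i)" for i
  proof (rule bounded_linear_intro[of _ 1])
    fix v :: 'b
    have "(norm (axis i v $ j))\<^sup>2 = (if j = i then (norm v)\<^sup>2 else 0)" for j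
      by (simp add: axis_def)
    then show "norm (axis i v) \<le> norm v * 1" by (simp add: norm_vec_def L2_set_def)
  qed (simp_all add: axis_def vec_eq_iff)
  have eq: "(\<chi> i. v i) = (\<Sum>i\<in>UNIV. axis i (v i))" for v :: "'i \<Rightarrow> 'b"
    by (simp add: vec_eq_iff axis_def)
  show ?thesis
    unfolding eq by (intro has_derivative_sum bounded_linear.has_derivative[OF bl] assms)
qed

text \<open>The sigmas and the entries of the Newton tensors are polynomials in \<open>m0\<close>
  and the entries of \<open>P\<close>, so any class closed under constants, sums and products
  contains them as soon as it contains these data. The two instances are C^1 functions and functions
  of polynomial growth.\<close>

locale function_algebra =
  fixes A :: "(real^'n \<Rightarrow> real) \<Rightarrow> bool"
  assumes const: "A (\<lambda>x. c)"
    and add: "A f \<Longrightarrow> A g \<Longrightarrow> A (\<lambda>x. f x + g x)"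
    and mult: "A f \<Longrightarrow> A g \<Longrightarrow> A (\<lambda>x. f x * g x)"
begin

lemma sum: "(\<And>a. a \<in> S \<Longrightarrow> A (f a)) \<Longrightarrow> A (\<lambda>x. \<Sum>a\<in>S. f a x)"
  by (induction S rule: infinite_finite_induct) (auto intro: add const)

context
  fixes P :: "real^'n \<Rightarrow> real^'n^'n" and m0 :: "real^'n \<Rightarrow> real"
  assumes P: "\<And>i j. A (\<lambda>x. P x $ i $ j)" and m0: "A m0"
begin

lemma mpow: "A (\<lambda>x. mpow (P x) l $ i $ j)"
proof (induction l arbitrary: i j)
  case 0
  show ?case by (simp add: const)
next
  case (Suc l)
  then show ?case by (simp add: mpow_Suc matrix_matrix_mult_def sum mult P)
qed

lemma signed_trace: "A (\<lambda>x. signed_trace (m0 x) (P x) i)"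
proof -
  have "A (\<lambda>x. if i = 0 then m0 x else 0)" using m0 const[of 0] by (cases "i = 0") auto
  then show ?thesis unfolding signed_trace_def trace_def by (intro add mult const sum mpow)
qed

lemma sigma_tr: "A (\<lambda>x. sigma_tr k (m0 x) (P x))"
proof (induction k rule: less_induct)
  case (less k)
  show ?case
  proof (cases k)
    case 0
    then show ?thesis by (simp add: const)
  next
    case (Suc n)
    have "A (\<lambda>x. (\<Sum>i\<le>n. signed_trace (m0 x) (P x) i * sigma_tr (n - i) (m0 x) (P x)) * inverse (real (Suc n)))"
      by (intro mult sum const signed_trace less.IH) (simp add: Suc)
    then show ?thesis by (simp add: Suc sigma_tr_def power_sum_seq.simps(2) divide_inverse del: of_nat_Suc)
  qed
qed

lemma newton_tensor: "A (\<lambda>x. newton_tensor k (m0 x) (P x) $ i $ j)"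
  by (simp add: newton_tensor_def) (intro sum mult const sigma_tr mpow)

end

end

interpretation C1: function_algebra "Ck 1"
  by unfold_locales (rule Ck_1_const Ck_1_add Ck_1_mult; assumption)+

interpretation PB: function_algebra "poly_bounded_on UNIV"
  by unfold_locales (rule poly_bounded_on_const poly_bounded_on_add poly_bounded_on_mult; assumption)+

lemma partial_mult:
  assumes "Ck 1 f" "Ck 1 g"
  shows "partial i (\<lambda>x. f x * g x) x = partial i f x * g x + f x * partial i g x"
  using partial_eqI[OF has_derivative_mult[OF assms[THEN Ck_1_has_derivative]], where i = i and x = x] by simp

lemma partial_sum:
  assumes "\<And>a. a \<in> S \<Longrightarrow> Ck 1 (f a)"
  shows "partial i (\<lambda>x. \<Sum>a\<in>S. f a x) x = (\<Sum>a\<in>S. partial i (f a) x)"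
  by (rule partial_eqI) (intro has_derivative_sum Ck_1_has_derivative assms)

lemma partial_exp_uminus:
  assumes "Ck 1 f"
  shows "partial i (\<lambda>x. exp (- f x)) x = - partial i f x * exp (- f x)"
  by (rule partial_eqI[THEN trans, OF has_derivative_exp[OF has_derivative_minus[OF Ck_1_has_derivative[OF assms]]]]) simp

lemma Ck_1_exp_uminus: "Ck 1 f \<Longrightarrow> Ck 1 (\<lambda>x. exp (- f x))"
  by (erule Ck_1_compose_real[where g = "\<lambda>t. exp (- t)" and g' = "\<lambda>t. - exp (- t)"])
     (auto intro!: derivative_eq_intros continuous_intros)

section \<open>Divergence identities for a density on flat space\<close>

locale flat_density =
  fixes \<phi> :: "real^'n \<Rightarrow> real" and lam :: real
  assumes smooth: "smooth \<phi>"
begin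

abbreviation P where "P \<equiv> Ric_tilde lam \<phi>"

definition m0 where "m0 x = Y_tilde lam \<phi> x - lam"

abbreviation T where "T k x \<equiv> newton_tensor k (m0 x) (P x)"

definition P' where "P' x h = (\<chi> i j. frechet_derivative (partial j (partial i \<phi>)) (at x) h)"

definition m0' where
  "m0' x h = - (\<Sum>l\<in>UNIV. partial l \<phi> x * frechet_derivative (partial l \<phi>) (at x) h) + lam * frechet_derivative \<phi> (at x) h"

lemma C1: "Ck 1 \<phi>" "Ck 1 (partial i \<phi>)" "Ck 1 (partial j (partial i \<phi>))"
  by (intro smooth_Ck smooth smooth_partial)+

lemma hessian_nth: "hessian \<phi> x $ i $ j = partial j (partial i \<phi>) x"
proof -
  have "(grad \<phi> has_derivative (\<lambda>h. \<chi> i. frechet_derivative (partial i \<phi>) (at x) h)) (at x)"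
    unfolding grad_def[abs_def] by (intro has_derivative_vec_lambda Ck_1_has_derivative C1)
  from frechet_derivative_at[OF this, symmetric] show ?thesis
    unfolding hessian_def jacobian_def matrix_def by simp
qed

lemma P_nth: "P x $ i $ j = partial j (partial i \<phi>) x + (- lam) * mat 1 $ i $ j"
  by (simp add: Ric_tilde_def hessian_nth mat_def)

lemma P_sym: "transpose (P x) = P x"
proof -
  have "P x $ j $ i = P x $ i $ j" for i j
    unfolding Ric_tilde_def by (simp add: hessian_nth mat_def partial_commute[OF smooth_Ck[OF smooth], where i = i and j = j])
  then show ?thesis by (simp add: transpose_def vec_eq_iff)
qed

lemma P_has_derivative: "(P has_derivative P' x) (at x)"
proof -
  have "P = (\<lambda>x. (\<chi> i j. partial j (partial i \<phi>) x) - mat lam)"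
    by (simp add: fun_eq_iff vec_eq_iff Ric_tilde_def hessian_nth)
  moreover have "((\<lambda>x. \<chi> i j. partial j (partial i \<phi>) x) has_derivative P' x) (at x)"
    unfolding P'_def[abs_def] by (intro has_derivative_vec_lambda Ck_1_has_derivative C1)
  ultimately show ?thesis using has_derivative_diff[OF _ has_derivative_const, of _ "P' x"] by simp
qed

lemma m0_eq: "m0 x = - (1/2) * (\<Sum>l\<in>UNIV. partial l \<phi> x * partial l \<phi> x) + lam * \<phi> x + (- lam)"
  by (simp add: m0_def Y_tilde_def grad_def power2_norm_eq_inner inner_vec_def algebra_simps)

lemma m0_has_derivative: "(m0 has_derivative m0' x) (at x)"
proof -
  have "m0 = (\<lambda>x. - (1/2) * (\<Sum>l\<in>UNIV. partial l \<phi> x * partial l \<phi> x) + lam * \<phi> x + (- lam))"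
    using m0_eq by blast
  moreover have "((\<lambda>x. - (1/2) * (\<Sum>l\<in>UNIV. partial l \<phi> x * partial l \<phi> x) + lam * \<phi> x + (- lam)) has_derivative
     (\<lambda>h. - (1/2) * (\<Sum>l\<in>UNIV. partial l \<phi> x * frechet_derivative (partial l \<phi>) (at x) h + frechet_derivative (partial l \<phi>) (at x) h * partial l \<phi> x)
       + lam * frechet_derivative \<phi> (at x) h + 0)) (at x)"
    by (intro has_derivative_add has_derivative_mult_right has_derivative_sum has_derivative_mult has_derivative_const
        Ck_1_has_derivative C1)
  moreover have "(\<lambda>h. - (1/2) * (\<Sum>l\<in>UNIV. partial l \<phi> x * frechet_derivative (partial l \<phi>) (at x) h + frechet_derivative (partial l \<phi>) (at x) h * partial l \<phi> x)
       + lam * frechet_derivative \<phi> (at x) h + 0) = m0' x"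
    by (simp add: fun_eq_iff m0'_def sum_distrib_left sum_negf mult.commute)
  ultimately show ?thesis by simp
qed

text \<open>Differentiating -|\<nabla>\<phi>|^2 / 2 gives minus the Hessian applied to the gradient;
  the term \<open>lam * \<phi>\<close> in \<open>Y_tilde\<close> supplies the shift that turns the
  Hessian into P.\<close>

lemma m0'_axis: "m0' x (axis i 1) = - (\<Sum>l\<in>UNIV. P x $ l $ i * partial l \<phi> x)"
proof -
  have "(\<Sum>l\<in>UNIV. P x $ l $ i * partial l \<phi> x)
     = (\<Sum>l\<in>UNIV. partial l \<phi> x * partial i (partial l \<phi>) x) - lam * (\<Sum>l\<in>UNIV. partial l \<phi> x * mat 1 $ l $ i)"
    by (simp add: P_nth right_diff_distrib sum_subtractf sum_distrib_left mult_ac)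
  then show ?thesis unfolding sum_mult_mat_1 m0'_def by simp
qed

sublocale D: matrix_deriv P m0 x "P' x" "m0' x" for x
  by unfold_locales (rule P_has_derivative m0_has_derivative)+

lemma codazzi: "P' x (axis i 1) $ l $ j = P' x (axis j 1) $ l $ i"
  by (simp add: P'_def partial_commute[OF smooth_Ck[OF smooth_partial[OF smooth]], where i = i and j = j])

lemma C1_P: "Ck 1 (\<lambda>x. P x $ i $ j)"
  unfolding P_nth by (intro C1.add C1 C1.const)

lemma C1_m0: "Ck 1 m0"
  unfolding m0_eq[abs_def] by (intro C1.add C1.mult C1.sum C1 C1.const)

lemmas C1_T = C1.newton_tensor[OF C1_P C1_m0]

lemma partial_T: "partial i (\<lambda>x. T k x $ i $ j) x = D.newton' x k (axis i 1) $ i $ j"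
  by (rule partial_eqI[OF bounded_linear.has_derivative[OF bounded_linear_vec_nth
        bounded_linear.has_derivative[OF bounded_linear_vec_nth D.newton_tensor_has_derivative]]])

lemma sigma_hat_eq: "sigma_hat lam j \<phi> x = sigma_tr j (m0 x) (P x)"
  by (simp add: sigma_hat_def m0_def sigma_inf_mat_eq_sigma_tr P_sym)

lemma E_hat_eq: "E_hat lam (Suc n) \<phi> x = - (P x ** T n x)"
  unfolding E_hat_def sigma_hat_eq by (rule sum_eq_newton_tensor)

text \<open>The part of the weighted divergence of \<open>E_hat\<close> that involves third derivatives of \<open>\<phi>\<close>
  vanishes because \<open>\<nabla> Y_tilde = - P \<nabla> \<phi>\<close>.\<close>
lemma div_T_grad:
  "(\<Sum>i\<in>UNIV. \<Sum>j\<in>UNIV. D.newton' x (Suc n) (axis i 1) $ i $ j * partial j \<phi> x)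
   = (\<Sum>i\<in>UNIV. partial i \<phi> x * (\<Sum>j\<in>UNIV. E_hat lam (Suc n) \<phi> x $ i $ j * partial j \<phi> x))"
proof -
  let ?p = "\<lambda>j. partial j \<phi> x"
  have eq: "(\<Sum>i\<in>UNIV. m0' x (axis i 1) * T n x $ i $ j) = (\<Sum>l\<in>UNIV. ?p l * E_hat lam (Suc n) \<phi> x $ l $ j)" for j
  proof -
    have "(\<Sum>i\<in>UNIV. m0' x (axis i 1) * T n x $ i $ j) = - (\<Sum>i\<in>UNIV. \<Sum>l\<in>UNIV. ?p l * (P x $ l $ i * T n x $ i $ j))"
      unfolding m0'_axis by (simp add: sum_distrib_right sum_distrib_left sum_negf mult_ac)
    also have "\<dots> = - (\<Sum>l\<in>UNIV. \<Sum>i\<in>UNIV. ?p l * (P x $ l $ i * T n x $ i $ j))"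
      by (subst sum.swap) (rule refl)
    also have "\<dots> = (\<Sum>l\<in>UNIV. ?p l * E_hat lam (Suc n) \<phi> x $ l $ j)"
      by (simp add: E_hat_eq matrix_matrix_mult_def sum_distrib_left sum_negf)
    finally show ?thesis .
  qed
  have "(\<Sum>i\<in>UNIV. \<Sum>j\<in>UNIV. D.newton' x (Suc n) (axis i 1) $ i $ j * ?p j)
     = (\<Sum>j\<in>UNIV. (\<Sum>i\<in>UNIV. D.newton' x (Suc n) (axis i 1) $ i $ j) * ?p j)"
    unfolding sum_distrib_right by (rule sum.swap)
  also have "\<dots> = (\<Sum>j\<in>UNIV. (\<Sum>i\<in>UNIV. m0' x (axis i 1) * T n x $ i $ j) * ?p j)"
    using D.div_newton_tensor[OF codazzi] by (simp del: D.newton'.simps)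
  also have "\<dots> = (\<Sum>j\<in>UNIV. (\<Sum>l\<in>UNIV. ?p l * E_hat lam (Suc n) \<phi> x $ l $ j) * ?p j)"
    unfolding eq ..
  also have "\<dots> = (\<Sum>l\<in>UNIV. ?p l * (\<Sum>j\<in>UNIV. E_hat lam (Suc n) \<phi> x $ l $ j * ?p j))"
    unfolding sum_distrib_right sum_distrib_left mult.assoc by (rule sum.swap)
  finally show ?thesis .
qed

definition E_hess where
  "E_hess k x = (\<Sum>i\<in>UNIV. \<Sum>j\<in>UNIV. E_hat lam k \<phi> x $ i $ j * partial i (partial j \<phi>) x)"

text \<open>The Hessian is P + lam, so the pairing splits. The second term integrates to zero by the
  hypothesis on the trace of \<open>E_hat\<close>, leaving the quantity with a sign.\<close>

lemma E_hess_eq: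
  "E_hess (Suc n) x = - trace (T n x ** (P x ** P x)) + lam * trace (E_hat lam (Suc n) \<phi> x)"
proof -
  let ?E = "E_hat lam (Suc n) \<phi> x"
  have "E_hess (Suc n) x = trace (?E ** (P x + mat lam))"
    unfolding E_hess_def trace_def matrix_matrix_mult_def
    by (simp add: Ric_tilde_def hessian_nth)
  also have "\<dots> = trace (?E ** P x) + trace (?E ** mat lam)"
    by (simp add: mat_bb.add_right trace_add)
  also have "?E ** mat lam = lam *\<^sub>R ?E"
    by (simp add: matrix_matrix_mult_def mat_def vec_eq_iff if_distrib cong: if_cong)
  also have "trace (?E ** P x) = - trace (T n x ** (P x ** P x))"
  proof -
    have "trace (?E ** P x) = trace (- 1 *\<^sub>R (T n x ** (P x ** P x)))"
      unfolding E_hat_eq newton_tensor_commute by (simp add: mat_bb.minus_left matrix_mul_assoc)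
    then show ?thesis unfolding trace_scaleR by simp
  qed
  finally show ?thesis by (simp add: trace_scaleR)
qed

definition flux where
  "flux k i x = (\<Sum>j\<in>UNIV. E_hat lam k \<phi> x $ i $ j * partial j \<phi> x)"

context
  fixes n s
  assumes sigma_const: "\<And>x. sigma_hat lam (Suc n) \<phi> x = s"
begin

text \<open>From T(k) = \<sigma>(k) I - P T(k-1): with \<sigma>(k) constant, \<open>E_hat\<close>
  differs from a Newton tensor by a constant multiple of the identity and hence has the same
  divergence. This is where constancy of \<open>sigma_hat\<close> enters.\<close>

lemma E_hat_nth: "E_hat lam (Suc n) \<phi> x $ i $ j = T (Suc n) x $ i $ j + (- s) * mat 1 $ i $ j"
  using sigma_const[of x] by (simp add: E_hat_eq newton_tensor_Suc sigma_hat_eq)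

lemma C1_E_hat: "Ck 1 (\<lambda>x. E_hat lam (Suc n) \<phi> x $ i $ j)"
  unfolding E_hat_nth by (intro C1.add C1_T C1.const)

lemma C1_flux: "Ck 1 (flux (Suc n) i)"
  unfolding flux_def[abs_def] by (intro C1.sum C1.mult C1_E_hat C1)

lemma partial_E_hat: "partial i (\<lambda>x. E_hat lam (Suc n) \<phi> x $ i $ j) x = D.newton' x (Suc n) (axis i 1) $ i $ j"
proof -
  have "((\<lambda>x. E_hat lam (Suc n) \<phi> x $ i $ j) has_derivative frechet_derivative (\<lambda>x. T (Suc n) x $ i $ j) (at x)) (at x)"
    unfolding E_hat_nth
    using has_derivative_add[OF Ck_1_has_derivative[OF C1_T[where k = "Suc n" and i = i and j = j]]
        has_derivative_const[where c = "- s * mat 1 $ i $ j"]] by simp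
  from partial_eqI[OF this] show ?thesis by (simp only: partial_T)
qed

text \<open>The first term on the right is the one that differentiating the weight exp(-\<phi>)
  removes, so the weighted flux has divergence \<open>E_hess\<close> times the weight. Third
  derivatives of \<phi> are absent from the right side.\<close>

lemma partial_flux:
  "(\<Sum>i\<in>UNIV. partial i (flux (Suc n) i) x) = (\<Sum>i\<in>UNIV. partial i \<phi> x * flux (Suc n) i x) + E_hess (Suc n) x"
proof -
  have "partial i (flux (Suc n) i) x = (\<Sum>j\<in>UNIV. D.newton' x (Suc n) (axis i 1) $ i $ j * partial j \<phi> x)
     + (\<Sum>j\<in>UNIV. E_hat lam (Suc n) \<phi> x $ i $ j * partial i (partial j \<phi>) x)" for i
    unfolding flux_def[abs_def]
    by (simp add: partial_sum partial_mult C1.mult C1_E_hat C1 partial_E_hat sum.distrib del: D.newton'.simps One_nat_def)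
  then show ?thesis
    by (simp add: sum.distrib div_T_grad E_hess_def flux_def[symmetric] del: D.newton'.simps)
qed

lemma div_cutoff_flux:
  assumes "Ck 1 \<eta>"
  shows "(\<Sum>i\<in>UNIV. partial i (\<lambda>x. \<eta> x * (exp (- \<phi> x) * flux (Suc n) i x)) x)
    = ((\<Sum>i\<in>UNIV. partial i \<eta> x * flux (Suc n) i x) + \<eta> x * E_hess (Suc n) x) * exp (- \<phi> x)"
proof -
  have eq: "partial i (\<lambda>x. \<eta> x * (exp (- \<phi> x) * flux (Suc n) i x)) x
     = (partial i \<eta> x * flux (Suc n) i x) * exp (- \<phi> x) +
       \<eta> x * exp (- \<phi> x) * (partial i (flux (Suc n) i) x - partial i \<phi> x * flux (Suc n) i x)" for i
    using assms C1 C1_flux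
    by (simp add: partial_mult partial_exp_uminus C1.mult Ck_1_exp_uminus algebra_simps del: One_nat_def)
  have "(\<Sum>i\<in>UNIV. partial i (\<lambda>x. \<eta> x * (exp (- \<phi> x) * flux (Suc n) i x)) x)
    = (\<Sum>i\<in>UNIV. partial i \<eta> x * flux (Suc n) i x) * exp (- \<phi> x) + \<eta> x * exp (- \<phi> x) *
      ((\<Sum>i\<in>UNIV. partial i (flux (Suc n) i) x) - (\<Sum>i\<in>UNIV. partial i \<phi> x * flux (Suc n) i x))"
    unfolding eq by (simp only: sum.distrib sum_subtractf sum_distrib_left[symmetric] sum_distrib_right[symmetric])
  then show ?thesis unfolding partial_flux by (simp add: algebra_simps)
qed

context
  fixes c K
  assumes growth: "poly_growth1 \<phi>" "\<And>i. poly_growth1 (partial i \<phi>)"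
    and c: "c > 0" and lower: "\<And>x. \<phi> x \<ge> c * (norm x)\<^sup>2 - K"
begin

lemma PB: "poly_bounded_on UNIV \<phi>" "poly_bounded_on UNIV (partial i \<phi>)" "poly_bounded_on UNIV (partial j (partial i \<phi>))"
  by (rule poly_bounded_UNIV, rule Ck_1_continuous, rule C1, rule poly_growth1D, rule growth)+

lemma PB_T: "poly_bounded_on UNIV (\<lambda>x. T k x $ i $ j)"
proof (rule PB.newton_tensor)
  show "poly_bounded_on UNIV (\<lambda>x. P x $ i $ j)" for i j
    unfolding P_nth by (intro PB.add PB PB.const)
  show "poly_bounded_on UNIV m0"
    unfolding m0_eq[abs_def] by (intro PB.add PB.mult PB.sum PB PB.const)
qed

lemma PB_E_hat: "poly_bounded_on UNIV (\<lambda>x. E_hat lam (Suc n) \<phi> x $ i $ j)"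
  unfolding E_hat_nth by (intro PB.add PB_T PB.const)

lemma PB_flux: "poly_bounded_on UNIV (flux (Suc n) i)"
  unfolding flux_def[abs_def] by (intro PB.sum PB.mult PB_E_hat PB)

lemma C1_E_hess: "Ck 1 (E_hess (Suc n))"
  unfolding E_hess_def[abs_def] by (intro C1.sum C1.mult C1_E_hat C1)

lemma PB_E_hess: "poly_bounded_on UNIV (E_hess (Suc n))"
  unfolding E_hess_def[abs_def] by (intro PB.sum PB.mult PB_E_hat PB)

text \<open>For each cutoff the divergence integrates to zero. The gradient of the cutoff tends to 0
  pointwise and is bounded by 4 |x| uniformly in m, because the radius parameter
  \<open>Suc m\<close> is at least 1; the Gaussian weight makes this growth integrable.\<close>

lemma integral_E_hess:
  "integrable lborel (\<lambda>x. E_hess (Suc n) x * exp (- \<phi> x))" "(\<integral>x. E_hess (Suc n) x * exp (- \<phi> x) \<partial>lborel) = 0"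
proof -
  show "integrable lborel (\<lambda>x. E_hess (Suc n) x * exp (- \<phi> x))"
    by (rule integrable_poly_bounded_mult_exp[OF _ PB_E_hess _ c lower]) (intro Ck_1_continuous C1_E_hess C1)+
  define F where "F = (\<lambda>m i x. cutoff (real (Suc m)) x * (exp (- \<phi> x) * flux (Suc n) i x))"
  define a where "a = (\<lambda>m x. \<Sum>i\<in>UNIV. partial i (F m i) x)"
  have cut: "Ck 1 (cutoff (real (Suc m)) :: real^'n \<Rightarrow> real)" for m by (rule Ck_1_cutoff) simp
  have F: "Ck 1 (F m i)" for m i
    unfolding F_def by (intro C1.mult cut Ck_1_exp_uminus C1 C1_flux)
  have supp: "F m i x = 0" if "norm x \<ge> real (Suc m)" for m i x
    unfolding F_def using cutoff_eq_0[OF _ that] by simp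
  have a0: "integral\<^sup>L lborel (a m) = 0" for m
    unfolding a_def using integral_partial_compact_support[OF F supp] by simp
  \<comment> \<open>Term by term, \<open>a m\<close> contains third derivatives of \<phi>, for which
    no growth bound is available. In this form only second derivatives occur, so the majorant
    \<open>w\<close> is integrable.\<close>
  have a_eq: "a m x = ((\<Sum>i\<in>UNIV. partial i (cutoff (real (Suc m))) x * flux (Suc n) i x)
      + cutoff (real (Suc m)) x * E_hess (Suc n) x) * exp (- \<phi> x)" for m x
    unfolding a_def F_def by (rule div_cutoff_flux[OF cut])
  define w where "w = (\<lambda>x. ((\<Sum>i\<in>UNIV. 4 * norm x * \<bar>flux (Suc n) i x\<bar>) + \<bar>E_hess (Suc n) x\<bar>) * exp (- \<phi> x))"
  have w: "integrable lborel w"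
    unfolding w_def
    by (rule integrable_poly_bounded_mult_exp[OF _ _ _ c lower])
       (intro continuous_intros poly_bounded_on_intros Ck_1_continuous C1_E_hess C1_flux C1 PB_flux PB_E_hess)+
  have bound: "norm (a m x) \<le> w x" for m x
  proof -
    have 1: "\<bar>partial i (cutoff (real (Suc m))) x\<bar> \<le> 4 * norm x" for i
    proof -
      have "4 * norm x / real (Suc m) \<le> 4 * norm x / 1" by (intro divide_left_mono) auto
      then show ?thesis using partial_cutoff_bound[where R = "real (Suc m)" and i = i and x = x] by simp
    qed
    have 2: "\<bar>cutoff (real (Suc m)) x\<bar> \<le> 1" using cutoff_bounds[of "real (Suc m)" x] by simp
    have "\<bar>(\<Sum>i\<in>UNIV. partial i (cutoff (real (Suc m))) x * flux (Suc n) i x) + cutoff (real (Suc m)) x * E_hess (Suc n) x\<bar>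
      \<le> (\<Sum>i\<in>UNIV. \<bar>partial i (cutoff (real (Suc m))) x * flux (Suc n) i x\<bar>) + \<bar>cutoff (real (Suc m)) x * E_hess (Suc n) x\<bar>"
      by (intro order_trans[OF abs_triangle_ineq] add_right_mono sum_abs)
    also have "\<dots> \<le> (\<Sum>i\<in>UNIV. 4 * norm x * \<bar>flux (Suc n) i x\<bar>) + 1 * \<bar>E_hess (Suc n) x\<bar>"
      unfolding abs_mult by (intro add_mono sum_mono mult_right_mono 1 2) auto
    finally show ?thesis unfolding a_eq w_def real_norm_def abs_mult abs_exp_cancel
      by (intro mult_right_mono) auto
  qed
  have lim: "(\<lambda>m. a m x) \<longlonglongrightarrow> E_hess (Suc n) x * exp (- \<phi> x)" for x
  proof -
    have "(\<lambda>m. a m x) \<longlonglongrightarrow> ((\<Sum>i\<in>UNIV. 0 * flux (Suc n) i x) + 1 * E_hess (Suc n) x) * exp (- \<phi> x)"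
      unfolding a_eq by (intro tendsto_mult tendsto_add tendsto_sum partial_cutoff_tendsto cutoff_tendsto tendsto_const)
    then show ?thesis by simp
  qed
  have meas: "(\<lambda>x. E_hess (Suc n) x * exp (- \<phi> x)) \<in> borel_measurable lborel" "a m \<in> borel_measurable lborel" for m
  proof -
    have "continuous_on UNIV (\<lambda>x. E_hess (Suc n) x * exp (- \<phi> x))"
      by (intro continuous_intros Ck_1_continuous C1_E_hess C1)
    then show "(\<lambda>x. E_hess (Suc n) x * exp (- \<phi> x)) \<in> borel_measurable lborel"
      by (simp add: borel_measurable_continuous_onI)
    have "continuous_on UNIV (a m)"
      unfolding a_def by (intro continuous_intros Ck_1_partial_continuous F)
    then show "a m \<in> borel_measurable lborel"
      by (simp add: borel_measurable_continuous_onI)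
  qed
  have "(\<lambda>m. integral\<^sup>L lborel (a m)) \<longlonglongrightarrow> (\<integral>x. E_hess (Suc n) x * exp (- \<phi> x) \<partial>lborel)"
    by (rule integral_dominated_convergence[OF meas w]) (use lim bound in auto)
  then show "(\<integral>x. E_hess (Suc n) x * exp (- \<phi> x) \<partial>lborel) = 0"
    using LIMSEQ_unique[OF _ tendsto_const] by (simp add: a0)
qed

lemma P_eq_0:
  assumes trE: "has_bochner_integral lborel (\<lambda>x. trace (E_hat lam (Suc n) \<phi> x) * exp (- \<phi> x)) 0"
    and pos: "\<And>j x. j \<in> {1..Suc n} \<Longrightarrow> (-1) ^ j * sigma_hat lam j \<phi> x > 0"
  shows "P x = 0"
proof -
  define q where "q = (\<lambda>x. (-1) ^ n * trace (T n x ** (P x ** P x)))"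
  have pos': "\<And>j x. j \<in> {1..Suc n} \<Longrightarrow> (-1) ^ j * sigma_tr j (m0 x) (P x) > 0"
    using pos by (simp add: sigma_hat_eq)
  have q_nonneg: "q x \<ge> 0" for x
    unfolding q_def using newton_tensor_trace_sign(1)[OF P_sym pos'] .
  \<comment> \<open>Both terms on the right integrate to zero, the first by hypothesis and the
    second by \<open>integral_E_hess\<close>. The sign (-1)^n in \<open>q\<close> makes the left
    side nonnegative.\<close>
  have q_eq: "q x * exp (- \<phi> x) = (-1) ^ n * (lam * (trace (E_hat lam (Suc n) \<phi> x) * exp (- \<phi> x)) - E_hess (Suc n) x * exp (- \<phi> x))" for x
    unfolding q_def E_hess_eq by (simp add: algebra_simps)
  have int: "integrable lborel (\<lambda>x. q x * exp (- \<phi> x))"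
    unfolding q_eq using trE integral_E_hess(1) by (auto simp: has_bochner_integral_iff)
  have "(\<integral>x. q x * exp (- \<phi> x) \<partial>lborel) = 0"
    unfolding q_eq using trE integral_E_hess by (simp add: has_bochner_integral_iff)
  then have AE: "AE x in lborel. q x * exp (- \<phi> x) = 0"
    by (subst (asm) integral_nonneg_eq_0_iff_AE[OF int]) (auto simp: q_nonneg)
  have tr_cont: "continuous_on UNIV (\<lambda>x. trace (E_hat lam (Suc n) \<phi> x))"
    unfolding trace_def by (intro continuous_intros Ck_1_continuous C1_E_hat)
  have cont: "continuous_on UNIV (\<lambda>x. q x * exp (- \<phi> x))"
    unfolding q_eq by (intro tr_cont continuous_intros Ck_1_continuous[OF C1_E_hess] Ck_1_continuous[OF C1(1)])
  \<comment> \<open>Continuity upgrades the almost-everywhere statement: the set where the function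
    is nonzero is open and null, hence empty.\<close>
  have "q x * exp (- \<phi> x) = 0"
  proof (rule ccontr)
    assume ne: "q x * exp (- \<phi> x) \<noteq> 0"
    let ?U = "{x. q x * exp (- \<phi> x) \<noteq> 0}"
    have "open ?U" by (intro open_Collect_neq cont continuous_on_const)
    moreover have "?U \<in> null_sets lborel"
    proof -
      have "?U \<in> sets borel" using \<open>open ?U\<close> by simp
      then show ?thesis using AE by (subst AE_iff_null_sets) auto
    qed
    then have "negligible ?U" using negligible_iff_null_sets null_sets_completionI by blast
    ultimately show False using open_not_negligible[of ?U] ne by blast
  qed
  then have "trace (T n x ** (P x ** P x)) = 0" by (simp add: q_def)
  then show ?thesis using newton_tensor_trace_sign(2)[OF P_sym pos'] by blast
qed

end

end

lemma quadratic_if_P_eq_0: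
  assumes P0: "\<And>x. P x = 0" and lam: "lam \<noteq> 0"
  shows "\<exists>x0 d. \<forall>x. \<phi> x = lam / 2 * (norm (x - x0))\<^sup>2 + d"
proof -
  have H: "partial j (partial i \<phi>) x = lam * mat 1 $ i $ j" for i j x
    using P_nth[of x i j] by (simp add: P0)
  have "\<exists>b. \<forall>x\<in>UNIV. partial i \<phi> x - lam * x $ i = b" for i
  proof (rule has_derivative_zero_constant)
    fix x
    have "(partial i \<phi> has_derivative (\<lambda>h. \<Sum>j\<in>UNIV. h $ j * (lam * mat 1 $ i $ j))) (at x)"
      using has_derivative_sum_partial[of "partial i \<phi>" x] C1(2)[of i] unfolding H Ck_1_iff by blast
    moreover have "(\<Sum>j\<in>UNIV. h $ j * (lam * mat 1 $ i $ j)) = lam * h $ i" for h :: "real^'n"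
      by (simp add: mat_def if_distrib cong: if_cong)
    ultimately have d1: "(partial i \<phi> has_derivative (\<lambda>h. lam * h $ i)) (at x)" by simp
    have d2: "((\<lambda>x. lam * x $ i) has_derivative (\<lambda>h. lam * h $ i)) (at x)"
      by (intro has_derivative_mult_right bounded_linear_imp_has_derivative bounded_linear_vec_nth)
    show "((\<lambda>x. partial i \<phi> x - lam * x $ i) has_derivative (\<lambda>h. 0)) (at x within UNIV)"
      using has_derivative_diff[OF d1 d2] by simp
  qed simp
  then obtain b where b: "\<And>i x. partial i \<phi> x = lam * x $ i + b i"
    by (metis UNIV_I add.commute diff_add_cancel)
  \<comment> \<open>The zero of the affine gradient; completing the square there uses that lam is
    nonzero.\<close>
  define x0 :: "real^'n" where "x0 = (\<chi> i. - b i / lam)"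
  have "\<exists>d. \<forall>x\<in>UNIV. \<phi> x - lam / 2 * ((x - x0) \<bullet> (x - x0)) = d"
  proof (rule has_derivative_zero_constant)
    fix x
    have "(\<phi> has_derivative (\<lambda>h. \<Sum>j\<in>UNIV. h $ j * partial j \<phi> x)) (at x)"
      using has_derivative_sum_partial C1(1) Ck_1_iff by blast
    moreover have "(\<Sum>j\<in>UNIV. h $ j * partial j \<phi> x) = lam * (h \<bullet> (x - x0))" for h
    proof -
      have "h $ j * partial j \<phi> x = lam * (h $ j * (x - x0) $ j)" for j
        using lam by (simp add: b x0_def field_simps)
      then show ?thesis by (simp only: inner_vec_def sum_distrib_left inner_real_def)
    qed
    ultimately have d1: "(\<phi> has_derivative (\<lambda>h. lam * (h \<bullet> (x - x0)))) (at x)" by simp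
    have d2: "((\<lambda>x. lam / 2 * ((x - x0) \<bullet> (x - x0))) has_derivative (\<lambda>h. lam * (h \<bullet> (x - x0)))) (at x)"
      by (auto intro!: derivative_eq_intros simp: inner_commute)
    show "((\<lambda>x. \<phi> x - lam / 2 * ((x - x0) \<bullet> (x - x0))) has_derivative (\<lambda>h. 0)) (at x within UNIV)"
      using has_derivative_diff[OF d1 d2] by simp
  qed simp
  then obtain d where "\<And>x. \<phi> x - lam / 2 * ((x - x0) \<bullet> (x - x0)) = d" by auto
  then have "\<phi> x = lam / 2 * (norm (x - x0))\<^sup>2 + d" for x
    by (metis add.commute diff_add_cancel dot_square_norm)
  then show ?thesis by blast
qed

end

text \<open>With a = 1 / (4 \<tau>) the Gaussian integral is the power of 4 \<pi> \<tau> that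
  cancels the prefactor, so the total mass is exp(-d).\<close>

lemma gaussian_normalization:
  fixes x0 :: "real^'n"
  assumes \<tau>: "\<tau> > 0"
    and int: "has_bochner_integral lborel (\<lambda>x::real^'n. (4 * pi * \<tau>) powr (- real CARD('n) / 2) *
      exp (- ((norm (x - x0))\<^sup>2 / (4 * \<tau>) + d))) 1"
  shows "d = 0"
proof -
  let ?N = "CARD('n)"
  define A where "A = (4 * pi * \<tau>) powr (- real ?N / 2)"
  have M: "4 * pi * \<tau> > 0" using \<tau> by simp
  have "sqrt (4 * pi * \<tau>) ^ ?N = ((4 * pi * \<tau>) powr (1 / 2)) powr real ?N"
    using M by (simp only: powr_half_sqrt less_imp_le powr_realpow real_sqrt_gt_zero)
  then have "A * sqrt (4 * pi * \<tau>) ^ ?N = (4 * pi * \<tau>) powr (- real ?N / 2 + real ?N / 2)"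
    unfolding A_def powr_add by (simp add: powr_powr)
  then have "A * sqrt (4 * pi * \<tau>) ^ ?N = 1" using \<tau> by simp
  then have A: "A * sqrt (pi / (1 / (4 * \<tau>))) ^ ?N = 1" by (simp add: mult_ac)
  have "A * exp (- d) * sqrt (pi / (1 / (4 * \<tau>))) ^ ?N = exp (- d) * (A * sqrt (pi / (1 / (4 * \<tau>))) ^ ?N)"
    by (simp only: mult_ac)
  then have val: "A * exp (- d) * sqrt (pi / (1 / (4 * \<tau>))) ^ ?N = exp (- d)"
    unfolding A by simp
  have fn: "(A * exp (- d)) * exp (- (1 / (4 * \<tau>)) * (norm (x - x0))\<^sup>2)
     = A * exp (- ((norm (x - x0))\<^sup>2 / (4 * \<tau>) + d))" for x
    by (simp add: mult_exp_exp mult.assoc)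
  have "has_bochner_integral lborel (\<lambda>x::real^'n. (A * exp (- d)) * exp (- (1 / (4 * \<tau>)) * (norm (x - x0))\<^sup>2))
     (A * exp (- d) * sqrt (pi / (1 / (4 * \<tau>))) ^ ?N)"
    using \<tau> by (intro has_bochner_integral_mult_right has_bochner_integral_gaussian) simp
  then have "exp (- d) = 1"
    unfolding val fn by (rule has_bochner_integral_eq[OF _ int[folded A_def]])
  then show ?thesis by simp
qed

theorem theorem7p4:
  fixes \<phi> :: "real^'n \<Rightarrow> real" and \<tau> lam :: real and k :: nat
  assumes "k \<ge> 1"
    and "(\<phi>, \<tau>) \<in> C1_space"
    and "lam = 1 / (2 * \<tau>)"
    and "\<And>x. (sigma_hat lam k \<phi> has_derivative (\<lambda>_. 0)) (at x)"
    and "has_bochner_integral lborel (\<lambda>x. trace (E_hat lam k \<phi> x) * exp (- \<phi> x)) 0"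
    and "\<And>j x. j \<in> {1..k} \<Longrightarrow> (-1) ^ j * sigma_hat lam j \<phi> x > 0"
    and "\<exists>g :: real^'n \<Rightarrow> real. Ck 2 g
           \<and> (\<forall>x. x \<noteq> 0 \<longrightarrow> g x = (norm x)\<^sup>2 * \<phi> (x /\<^sub>R (norm x)\<^sup>2)) \<and> g 0 > 0"
  shows "\<exists>x0. \<forall>x. \<phi> x = (norm (x - x0))\<^sup>2 / (4 * \<tau>)"
proof -
  \<comment> \<open>The definite Newton tensor has index n = k - 1; the sign conditions up to k are
    what \<open>newton_tensor_trace_sign\<close> requires for it.\<close>
  obtain n where k: "k = Suc n" using assms(1) by (cases k) auto
  have smooth: "smooth \<phi>" and \<tau>: "\<tau> > 0"
    and norm1: "has_bochner_integral lborel (\<lambda>x. (4 * pi * \<tau>) powr (- real CARD('n) / 2) * exp (- \<phi> x)) 1"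
    using assms(2) by (auto simp: C1_space_def)
  interpret flat_density \<phi> lam by unfold_locales (rule smooth)
  obtain s where s: "\<And>x. sigma_hat lam (Suc n) \<phi> x = s"
    using has_derivative_zero_constant[of UNIV "sigma_hat lam k \<phi>"] assms(4) k by auto
  obtain g where g: "Ck 2 g" "g 0 > 0" "\<And>x. x \<noteq> 0 \<Longrightarrow> g x = (norm x)\<^sup>2 * \<phi> (x /\<^sub>R (norm x)\<^sup>2)"
    using assms(7) by blast
  \<comment> \<open>The hypothesis expresses g through \<phi> at the inverted point; as inversion is
    an involution it can be solved for \<phi>.\<close>
  have eq: "\<phi> x = (x \<bullet> x) * g (inversion x)" if "x \<noteq> 0" for x
  proof -
    have "norm (inversion x) \<noteq> 0" using that by (simp add: norm_inversion)
    then have "g (inversion x) = (norm (inversion x))\<^sup>2 * \<phi> (inversion (inversion x))"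
      using g(3)[of "inversion x"] by (simp add: inversion_def[of "inversion x"] dot_square_norm)
    then show ?thesis using that by (simp add: norm_inversion inversion_inversion dot_square_norm power_inverse)
  qed
  note growth = growth_of_inverted[OF g(1) eq]
  have "continuous_on UNIV g" using g(1) by (metis Ck_1_continuous Ck_SucD Suc_1)
  from lower_bound_of_inverted[OF this eq g(2) Ck_1_continuous[OF C1(1)]]
  obtain c K where c: "c > 0" "\<And>x. \<phi> x \<ge> c * (norm x)\<^sup>2 - K" by blast
  have "P x = 0" for x
    by (rule P_eq_0[OF s growth c]) (use assms(5,6) k in auto)
  moreover have "lam \<noteq> 0" using assms(3) \<tau> by simp
  ultimately obtain x0 d where "\<And>x. \<phi> x = lam / 2 * (norm (x - x0))\<^sup>2 + d"
    using quadratic_if_P_eq_0 by blast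
  then have \<phi>: "\<phi> x = (norm (x - x0))\<^sup>2 / (4 * \<tau>) + d" for x by (simp add: assms(3))
  have "d = 0" by (rule gaussian_normalization[OF \<tau>]) (use norm1 in \<open>simp add: \<phi>\<close>)
  then show ?thesis using \<phi> by auto
qed

end
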